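(* Let $(\mathcal{H},\langle\cdot,\cdot\rangle)$ be a separable complex Hilbert space, let $E$ be $\mathcal{H}$ regarded as a real symplectic vector space with $\sigma=\operatorname{Im}\langle\cdot,\cdot\rangle$, and let $h\in[0,+\infty)$. Let $Q_h:\Delta(E,0)\to\Delta(E,h\sigma)$ be the linear map determined by $$Q_h(W^0(f))=e^{-\frac h4\|f\|^2}W^h(f),\qquad f\in E .$$ Then: (i) $\|Q_h(c)\|_h\le\|c\|_0$ for every $c\in\Delta(E,0)$; (ii) for every $c\in\Delta(E,0)$, if $c\ge 0$ as an element of the $C^*$-algebra $\mathcal{W}(E,0)$, then $Q_h(c)\ge 0$ as an element of the $C^*$-algebra $\mathcal{W}(E,h\sigma)$. As a consequence, $Q_h$ extends from $\Delta(E,0)$ to a positive map $Q_h:\mathcal{W}(E,0)\to\mathcal{W}(E,h\sigma)$.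
   Context: Inner products are linear in the second argument; $\|f\|=\langle f,f\rangle^{1/2}$. For $h\ge0$, $\Delta(E,h\sigma)$ is the unital $*$-algebra with linear basis $\{W^h(f):f\in E\}$ and relations $W^h(f)W^h(g)=e^{-\frac i2h\sigma(f,g)}W^h(f+g)$, $W^h(f)^*=W^h(-f)$, $W^h(0)=I$. A state on $\Delta(E,h\sigma)$ is a linear functional $\omega$ with $\omega(A^*A)\ge0$ for all $A$ and $\omega(I)=1$. The norm $\|A\|_h=\sup_\omega\omega(A^*A)^{1/2}$ (supremum over all states of $\Delta(E,h\sigma)$) is a $C^*$-norm, and the Weyl $C^*$-algebra $\mathcal{W}(E,h\sigma)$ is the completion of $\Delta(E,h\sigma)$ in $\|\cdot\|_h$. For $h=0$ the algebra is commutative; identifying $W^0(f)$ with the function $g\mapsto e^{i\operatorname{Re}\langle f,g\rangle}$ on $E$, the norm $\|\cdot\|_0$ is the sup norm. *)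

theory Defs
  imports "HOL-Analysis.Analysis" "HOL-Library.Poly_Mapping"
begin

hide_const (open) Poly_Mapping.range Poly_Mapping.map Poly_Mapping.degree

section \<open>Complex Hilbert spaces\<close>

class complex_hilbert_space = banach +
  fixes scaleC :: "complex \<Rightarrow> 'a \<Rightarrow> 'a"  (infixr \<open>*\<^sub>C\<close> 75)
    and cinner :: "'a \<Rightarrow> 'a \<Rightarrow> complex"
  assumes scaleC_add_right: "a *\<^sub>C (x + y) = a *\<^sub>C x + a *\<^sub>C y"
    and scaleC_add_left: "(a + b) *\<^sub>C x = a *\<^sub>C x + b *\<^sub>C x"
    and scaleC_scaleC: "a *\<^sub>C (b *\<^sub>C x) = (a * b) *\<^sub>C x"
    and scaleC_of_real: "complex_of_real r *\<^sub>C x = r *\<^sub>R x"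
    and cinner_commute: "cinner x y = cnj (cinner y x)"
    and cinner_add_right: "cinner x (y + z) = cinner x y + cinner x z"
    and cinner_scaleC_right: "cinner x (a *\<^sub>C y) = a * cinner x y"
    and cinner_self: "cinner x x = complex_of_real ((norm x)\<^sup>2)"

definition sympl :: "'a::complex_hilbert_space \<Rightarrow> 'a \<Rightarrow> real" where
  "sympl f g = Im (cinner f g)"

section \<open>The Weyl algebra \<open>\<Delta>(E, h\<sigma>)\<close>\<close>

text \<open>
  An element is the finitely supported family of its coefficients in the basis of Weyl elements.
  The underlying vector space and the basis thus do not depend on \<open>h\<close>; the product does.
  (The convolution product that the library puts on this type is not used.)
\<close>

type_synonym 'a weyl = "'a \<Rightarrow>\<^sub>0 complex"

definition weyl_gen :: "'a \<Rightarrow> 'a weyl" where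
  "weyl_gen f = Poly_Mapping.single f 1"

definition weyl_scale :: "complex \<Rightarrow> 'a weyl \<Rightarrow> 'a weyl" where
  "weyl_scale z a = Poly_Mapping.map ((*) z) a"

definition weyl_mult ::
  "real \<Rightarrow> 'a::complex_hilbert_space weyl \<Rightarrow> 'a weyl \<Rightarrow> 'a weyl" where
  "weyl_mult h a b =
     (\<Sum>f\<in>Poly_Mapping.keys a. \<Sum>g\<in>Poly_Mapping.keys b.
        weyl_scale (Poly_Mapping.lookup a f * Poly_Mapping.lookup b g
                    * exp (- (\<i> / 2) * complex_of_real (h * sympl f g)))
          (weyl_gen (f + g)))"

definition weyl_star :: "'a::complex_hilbert_space weyl \<Rightarrow> 'a weyl" where
  "weyl_star a =
     (\<Sum>f\<in>Poly_Mapping.keys a. weyl_scale (cnj (Poly_Mapping.lookup a f)) (weyl_gen (- f)))"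

definition weyl_one :: "'a::complex_hilbert_space weyl" where
  "weyl_one = weyl_gen 0"

definition weyl_states :: "real \<Rightarrow> ('a::complex_hilbert_space weyl \<Rightarrow> complex) set" where
  "weyl_states h =
     {\<omega>. Vector_Spaces.linear weyl_scale (*) \<omega>
        \<and> (\<forall>a. \<omega> (weyl_mult h (weyl_star a) a) \<in> \<real>\<^sub>\<ge>\<^sub>0)
        \<and> \<omega> weyl_one = 1}"

definition weyl_norm :: "real \<Rightarrow> 'a::complex_hilbert_space weyl \<Rightarrow> real" where
  "weyl_norm h a = (SUP \<omega>\<in>weyl_states h. sqrt (Re (\<omega> (weyl_mult h (weyl_star a) a))))"

definition weyl_quant ::
  "real \<Rightarrow> 'a::complex_hilbert_space weyl \<Rightarrow> 'a weyl" where
  "weyl_quant h c =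
     (\<Sum>f\<in>Poly_Mapping.keys c.
        weyl_scale (Poly_Mapping.lookup c f)
          (weyl_scale (complex_of_real (exp (- (h / 4) * (norm f)\<^sup>2))) (weyl_gen f)))"

section \<open>The Weyl $C^*$-algebra \<open>\<W>(E, h\<sigma>)\<close>\<close>

text \<open>
  The completion consists of the classes of Cauchy sequences modulo null sequences. It is
  realised as a carrier set, since its algebra depends on the real parameter \<open>h\<close>.
\<close>

definition weyl_cauchy :: "real \<Rightarrow> (nat \<Rightarrow> 'a::complex_hilbert_space weyl) set" where
  "weyl_cauchy h = {x. \<forall>e>0. \<exists>M. \<forall>m\<ge>M. \<forall>n\<ge>M. weyl_norm h (x m - x n) < e}"

definition weyl_eqv ::
  "real \<Rightarrow> ((nat \<Rightarrow> 'a::complex_hilbert_space weyl) \<times> (nat \<Rightarrow> 'a weyl)) set" where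
  "weyl_eqv h = {(x, y). x \<in> weyl_cauchy h \<and> y \<in> weyl_cauchy h
                   \<and> (\<lambda>n. weyl_norm h (x n - y n)) \<longlonglongrightarrow> 0}"

type_synonym 'a weylC = "(nat \<Rightarrow> 'a weyl) set"

definition weylC :: "real \<Rightarrow> 'a::complex_hilbert_space weylC set" where
  "weylC h = weyl_cauchy h // weyl_eqv h"

definition weylC_emb :: "real \<Rightarrow> 'a::complex_hilbert_space weyl \<Rightarrow> 'a weylC" where
  "weylC_emb h a = weyl_eqv h `` {\<lambda>n. a}"

definition weylC_add ::
  "real \<Rightarrow> 'a::complex_hilbert_space weylC \<Rightarrow> 'a weylC \<Rightarrow> 'a weylC" where
  "weylC_add h X Y = (\<Union>x\<in>X. \<Union>y\<in>Y. weyl_eqv h `` {\<lambda>n. x n + y n})"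

definition weylC_scale ::
  "real \<Rightarrow> complex \<Rightarrow> 'a::complex_hilbert_space weylC \<Rightarrow> 'a weylC" where
  "weylC_scale h z X = (\<Union>x\<in>X. weyl_eqv h `` {\<lambda>n. weyl_scale z (x n)})"

definition weylC_mult ::
  "real \<Rightarrow> 'a::complex_hilbert_space weylC \<Rightarrow> 'a weylC \<Rightarrow> 'a weylC" where
  "weylC_mult h X Y = (\<Union>x\<in>X. \<Union>y\<in>Y. weyl_eqv h `` {\<lambda>n. weyl_mult h (x n) (y n)})"

definition weylC_star :: "real \<Rightarrow> 'a::complex_hilbert_space weylC \<Rightarrow> 'a weylC" where
  "weylC_star h X = (\<Union>x\<in>X. weyl_eqv h `` {\<lambda>n. weyl_star (x n)})"

text \<open>By continuity of the norm the limit is the same for all representatives.\<close>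

definition weylC_norm :: "real \<Rightarrow> 'a::complex_hilbert_space weylC \<Rightarrow> real" where
  "weylC_norm h X = (THE r. \<forall>x\<in>X. (\<lambda>n. weyl_norm h (x n)) \<longlonglongrightarrow> r)"

text \<open>Positive elements of a $C^*$-algebra are those of the form $Y^* Y$.\<close>

definition weylC_positive :: "real \<Rightarrow> 'a::complex_hilbert_space weylC \<Rightarrow> bool" where
  "weylC_positive h X \<longleftrightarrow> (\<exists>Y\<in>weylC h. X = weylC_mult h (weylC_star h Y) Y)"

definition weylC_linear ::
  "real \<Rightarrow> real \<Rightarrow> ('a::complex_hilbert_space weylC \<Rightarrow> 'a weylC) \<Rightarrow> bool" where
  "weylC_linear h k T \<longleftrightarrow>
     (\<forall>X\<in>weylC h. T X \<in> weylC k)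
   \<and> (\<forall>X\<in>weylC h. \<forall>Y\<in>weylC h. T (weylC_add h X Y) = weylC_add k (T X) (T Y))
   \<and> (\<forall>z. \<forall>X\<in>weylC h. T (weylC_scale h z X) = weylC_scale k z (T X))"

definition weylC_positive_map ::
  "real \<Rightarrow> real \<Rightarrow> ('a::complex_hilbert_space weylC \<Rightarrow> 'a weylC) \<Rightarrow> bool" where
  "weylC_positive_map h k T \<longleftrightarrow>
     weylC_linear h k T \<and> (\<forall>X\<in>weylC h. weylC_positive h X \<longrightarrow> weylC_positive k (T X))"

section \<open>Basic facts\<close>

lemma lookup_weyl_scale [simp]:
  "Poly_Mapping.lookup (weyl_scale z a) f = z * Poly_Mapping.lookup a f"
  by (simp add: weyl_scale_def Poly_Mapping.map.rep_eq when_def)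

lemma lookup_weyl_gen:
  "Poly_Mapping.lookup (weyl_gen f) g = (if f = g then 1 else 0)"
  by (simp add: weyl_gen_def Poly_Mapping.lookup_single when_def)

lemma keys_weyl_gen [simp]: "Poly_Mapping.keys (weyl_gen f) = {f}"
  by (simp add: weyl_gen_def)

lemma vector_space_weyl: "vector_space (weyl_scale :: complex \<Rightarrow> 'a weyl \<Rightarrow> 'a weyl)"
  by unfold_locales
     (auto intro!: poly_mapping_eqI simp: Poly_Mapping.lookup_add algebra_simps)

lemma sum_keys_superset:
  fixes F :: "'a \<Rightarrow> complex \<Rightarrow> 'b::comm_monoid_add"
  assumes "finite S" "Poly_Mapping.keys a \<subseteq> S" "\<And>f. F f 0 = 0"
  shows "(\<Sum>f\<in>Poly_Mapping.keys a. F f (Poly_Mapping.lookup a f)) =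
         (\<Sum>f\<in>S. F f (Poly_Mapping.lookup a f))"
  using assms by (intro sum.mono_neutral_left) (auto simp: Poly_Mapping.in_keys_iff)

lemma sum_keys_add:
  fixes F :: "'a \<Rightarrow> complex \<Rightarrow> 'b::comm_monoid_add"
  assumes z: "\<And>f. F f 0 = 0" and add: "\<And>f x y. F f (x + y) = F f x + F f y"
  shows "(\<Sum>f\<in>Poly_Mapping.keys (a + b). F f (Poly_Mapping.lookup (a + b) f)) =
         (\<Sum>f\<in>Poly_Mapping.keys a. F f (Poly_Mapping.lookup a f)) +
         (\<Sum>f\<in>Poly_Mapping.keys b. F f (Poly_Mapping.lookup b f))"
proof -
  let ?S = "Poly_Mapping.keys a \<union> Poly_Mapping.keys b"
  have "Poly_Mapping.keys (a + b) \<subseteq> ?S" by (rule Poly_Mapping.keys_add)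
  then show ?thesis
    using sum_keys_superset[of ?S "a + b" F] sum_keys_superset[of ?S a F]
      sum_keys_superset[of ?S b F] z
    by (simp add: Poly_Mapping.lookup_add add sum.distrib)
qed

lemma sum_keys_scale:
  fixes F :: "'a \<Rightarrow> complex \<Rightarrow> 'b::comm_monoid_add"
  assumes z: "\<And>f. F f 0 = 0"
  shows "(\<Sum>f\<in>Poly_Mapping.keys (weyl_scale c a). F f (Poly_Mapping.lookup (weyl_scale c a) f)) =
         (\<Sum>f\<in>Poly_Mapping.keys a. F f (c * Poly_Mapping.lookup a f))"
proof -
  have "Poly_Mapping.keys (weyl_scale c a) \<subseteq> Poly_Mapping.keys a"
    by (auto simp: Poly_Mapping.in_keys_iff)
  then show ?thesis
    using sum_keys_superset[of "Poly_Mapping.keys a" "weyl_scale c a" F] z by simp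
qed

interpretation weyl: vector_space weyl_scale
  by (rule vector_space_weyl)

lemma weyl_expansion:
  "a = (\<Sum>f\<in>Poly_Mapping.keys a. weyl_scale (Poly_Mapping.lookup a f) (weyl_gen f))"
  by (rule poly_mapping_eqI)
     (simp add: Poly_Mapping.lookup_sum lookup_weyl_gen if_distrib[of "(*) _"]
        Poly_Mapping.in_keys_iff cong: if_cong)

subsection \<open>The Weyl relations\<close>

lemma weyl_mult_gen:
  "weyl_mult h (weyl_gen f) (weyl_gen g) =
     weyl_scale (exp (- (\<i> / 2) * complex_of_real (h * sympl f g))) (weyl_gen (f + g))"
  by (simp add: weyl_mult_def lookup_weyl_gen)

lemma weyl_star_gen: "weyl_star (weyl_gen f) = weyl_gen (- f)"
  by (simp add: weyl_star_def lookup_weyl_gen)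

lemma weyl_quant_gen:
  "weyl_quant h (weyl_gen f) =
     weyl_scale (complex_of_real (exp (- (h / 4) * (norm f)\<^sup>2))) (weyl_gen f)"
  by (simp add: weyl_quant_def lookup_weyl_gen)

lemma linear_weyl_quant: "Vector_Spaces.linear weyl_scale weyl_scale (weyl_quant h)"
proof -
  let ?F = "\<lambda>f z. weyl_scale z
              (weyl_scale (complex_of_real (exp (- (h / 4) * (norm f)\<^sup>2))) (weyl_gen f))"
  have add: "weyl_quant h (a + b) = weyl_quant h a + weyl_quant h b" for a b :: "'a weyl"
    unfolding weyl_quant_def
    by (rule sum_keys_add[where F = ?F]) (simp_all add: weyl.scale_left_distrib del: weyl.scale_scale)
  have scale: "weyl_quant h (weyl_scale c a) = weyl_scale c (weyl_quant h a)"
    for a :: "'a weyl" and c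
    unfolding weyl_quant_def
    by (subst sum_keys_scale[where F = ?F])
       (simp_all add: weyl.scale_sum_right mult_ac)
  show ?thesis
    by unfold_locales (simp_all add: add scale)
qed

lemma weyl_induct [case_names gen add]:
  assumes "\<And>c f. P (weyl_scale c (weyl_gen f))" "\<And>a b. P a \<Longrightarrow> P b \<Longrightarrow> P (a + b)"
  shows "P a"
proof -
  have zero: "P 0" using assms(1)[of 0] by simp
  have "P (\<Sum>f\<in>S. weyl_scale (Poly_Mapping.lookup a f) (weyl_gen f))" if "finite S" for S
    using that by induction (simp_all add: assms zero)
  then show ?thesis
    by (subst weyl_expansion) simp
qed

lemma weyl_mult_add_left: "weyl_mult h (a + b) c = weyl_mult h a c + weyl_mult h b c"
  unfolding weyl_mult_def
  by (rule sum_keys_add[where F = "\<lambda>f z. \<Sum>g\<in>Poly_Mapping.keys c.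
        weyl_scale (z * Poly_Mapping.lookup c g
          * exp (- (\<i> / 2) * complex_of_real (h * sympl f g))) (weyl_gen (f + g))"])
     (simp_all only: distrib_right weyl.scale_left_distrib sum.distrib mult_zero_left
        weyl.scale_zero_left sum.neutral_const)

lemma weyl_mult_add_right: "weyl_mult h a (b + c) = weyl_mult h a b + weyl_mult h a c"
  unfolding weyl_mult_def sum.distrib[symmetric]
  by (rule sum.cong[OF refl], rule sum_keys_add[where F = "\<lambda>g z.
        weyl_scale (Poly_Mapping.lookup a f * z
          * exp (- (\<i> / 2) * complex_of_real (h * sympl f g))) (weyl_gen (f + g))" for f])
     (simp_all only: distrib_right distrib_left weyl.scale_left_distrib mult_zero_left
        mult_zero_right weyl.scale_zero_left)

lemma weyl_mult_scale_left: "weyl_mult h (weyl_scale z a) c = weyl_scale z (weyl_mult h a c)"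
  unfolding weyl_mult_def
  by (subst sum_keys_scale[where F = "\<lambda>f z. \<Sum>g\<in>Poly_Mapping.keys c.
        weyl_scale (z * Poly_Mapping.lookup c g
          * exp (- (\<i> / 2) * complex_of_real (h * sympl f g))) (weyl_gen (f + g))"])
     (simp_all add: weyl.scale_sum_right mult_ac)

lemma weyl_mult_scale_right: "weyl_mult h a (weyl_scale z c) = weyl_scale z (weyl_mult h a c)"
  unfolding weyl_mult_def weyl.scale_sum_right
  by (rule sum.cong[OF refl], subst sum_keys_scale[where F = "\<lambda>g z.
        weyl_scale (Poly_Mapping.lookup a f * z
          * exp (- (\<i> / 2) * complex_of_real (h * sympl f g))) (weyl_gen (f + g))" for f])
     (simp_all add: mult_ac)

lemma weyl_star_add: "weyl_star (a + b) = weyl_star a + weyl_star b"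
  unfolding weyl_star_def
  by (rule sum_keys_add[where F = "\<lambda>f z. weyl_scale (cnj z) (weyl_gen (- f))"])
     (simp_all add: weyl.scale_left_distrib)

lemma weyl_star_scale: "weyl_star (weyl_scale z a) = weyl_scale (cnj z) (weyl_star a)"
  unfolding weyl_star_def
  by (subst sum_keys_scale[where F = "\<lambda>f z. weyl_scale (cnj z) (weyl_gen (- f))"])
     (simp_all add: weyl.scale_sum_right)

lemma cinner_add_left: "cinner (x + y) z = cinner x z + cinner y z"
  by (metis cinner_add_right cinner_commute complex_cnj_add)

lemma sympl_add_left: "sympl (f + g) k = sympl f k + sympl g k"
  and sympl_add_right: "sympl f (g + k) = sympl f g + sympl f k"
  by (simp_all add: sympl_def cinner_add_left cinner_add_right)

lemma sympl_commute: "sympl g f = - sympl f g"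
  unfolding sympl_def by (subst cinner_commute) simp

lemma sympl_zero [simp]: "sympl 0 f = 0" "sympl f 0 = 0"
  using sympl_add_left[of 0 0 f] sympl_add_right[of f 0 0] by simp_all

lemma sympl_self [simp]: "sympl f f = 0"
  using sympl_commute[of f f] by simp

lemma sympl_minus [simp]: "sympl (- f) g = - sympl f g" "sympl f (- g) = - sympl f g"
  using sympl_add_left[of f "- f" g] sympl_add_right[of f g "- g"] by simp_all

lemma weyl_mult_assoc: "weyl_mult h (weyl_mult h a b) c = weyl_mult h a (weyl_mult h b c)"
proof (induction a rule: weyl_induct)
  case a: (gen z f)
  show ?case
  proof (induction b rule: weyl_induct)
    case b: (gen z' g)
    show ?case
      by (induction c rule: weyl_induct)
         (simp_all add: weyl_mult_gen weyl_mult_scale_left weyl_mult_scale_right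
            weyl_mult_add_right weyl_mult_add_left weyl.scale_right_distrib
            sympl_add_left sympl_add_right exp_add[symmetric] algebra_simps)
  qed (simp add: weyl_mult_add_right weyl_mult_add_left)
qed (simp add: weyl_mult_add_left)

lemma weyl_mult_one [simp]: "weyl_mult h weyl_one a = a" "weyl_mult h a weyl_one = a"
  by (induction a rule: weyl_induct)
     (simp_all add: weyl_one_def weyl_mult_gen weyl_mult_scale_left weyl_mult_scale_right
        weyl_mult_add_right weyl_mult_add_left)

lemma weyl_star_star: "weyl_star (weyl_star a) = a"
  by (induction a rule: weyl_induct) (simp_all add: weyl_star_gen weyl_star_scale weyl_star_add)

lemma weyl_star_mult: "weyl_star (weyl_mult h a b) = weyl_mult h (weyl_star b) (weyl_star a)"
proof (induction a rule: weyl_induct)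
  case a: (gen z f)
  show ?case
    by (induction b rule: weyl_induct)
       (auto simp: weyl_mult_gen weyl_mult_scale_left weyl_mult_scale_right weyl_star_gen
          weyl_star_scale weyl_star_add weyl_mult_add_right weyl_mult_add_left exp_cnj
          weyl.scale_right_distrib sympl_commute[of g f for g] algebra_simps)
qed (simp add: weyl_mult_add_left weyl_mult_add_right weyl_star_add)

subsection \<open>The supremum defining the norm is over a nonempty bounded set\<close>

lemma weyl_mult_zero [simp]: "weyl_mult h 0 c = 0" "weyl_mult h c 0 = 0"
  using weyl_mult_add_left[of h 0 0 c] weyl_mult_add_right[of h c 0 0] by simp_all

lemma weyl_star_zero [simp]: "weyl_star 0 = 0"
  using weyl_star_add[of 0 0] by simp

lemma weyl_mult_sum_left: "weyl_mult h (sum F I) c = (\<Sum>i\<in>I. weyl_mult h (F i) c)"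
  by (induction I rule: infinite_finite_induct) (simp_all add: weyl_mult_add_left)

lemma weyl_mult_sum_right: "weyl_mult h c (sum F I) = (\<Sum>i\<in>I. weyl_mult h c (F i))"
  by (induction I rule: infinite_finite_induct) (simp_all add: weyl_mult_add_right)

lemma weyl_star_sum: "weyl_star (sum F I) = (\<Sum>i\<in>I. weyl_star (F i))"
  by (induction I rule: infinite_finite_induct) (simp_all add: weyl_star_add)

lemma weyl_star_mult_expansion:
  "weyl_mult h (weyl_star a) a =
     (\<Sum>f\<in>Poly_Mapping.keys a. \<Sum>g\<in>Poly_Mapping.keys a.
        weyl_scale (cnj (Poly_Mapping.lookup a f) * Poly_Mapping.lookup a g
                    * exp (\<i> / 2 * complex_of_real (h * sympl f g)))
          (weyl_gen (g - f)))"
proof -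
  let ?S = "Poly_Mapping.keys a" and ?l = "Poly_Mapping.lookup a"
  have "weyl_mult h (weyl_star a) a =
          weyl_mult h (weyl_star (\<Sum>f\<in>?S. weyl_scale (?l f) (weyl_gen f)))
            (\<Sum>f\<in>?S. weyl_scale (?l f) (weyl_gen f))"
    by (simp flip: weyl_expansion)
  also have "\<dots> = (\<Sum>f\<in>?S. \<Sum>g\<in>?S. weyl_scale (cnj (?l f))
                     (weyl_scale (?l g) (weyl_mult h (weyl_gen (- f)) (weyl_gen g))))"
    by (simp only: weyl_star_sum weyl_mult_sum_left weyl_mult_sum_right weyl_star_scale
        weyl_star_gen weyl_mult_scale_left weyl_mult_scale_right weyl.scale_sum_right)
       (subst sum.swap, simp add: mult_ac)
  also have "\<dots> = (\<Sum>f\<in>?S. \<Sum>g\<in>?S.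
      weyl_scale (cnj (?l f) * ?l g * exp (\<i> / 2 * complex_of_real (h * sympl f g)))
        (weyl_gen (g - f)))"
    by (intro sum.cong refl) (simp add: weyl_mult_gen mult_ac)
  finally show ?thesis .
qed

lemma weyl_states_nonempty: "(\<lambda>a. Poly_Mapping.lookup a 0) \<in> weyl_states h"
proof -
  have "Poly_Mapping.lookup (weyl_mult h (weyl_star a) a) 0 =
          complex_of_real (\<Sum>f\<in>Poly_Mapping.keys a. (cmod (Poly_Mapping.lookup a f))\<^sup>2)"
    for a :: "'a weyl"
  proof -
    have "Poly_Mapping.lookup (weyl_mult h (weyl_star a) a) 0 =
            (\<Sum>f\<in>Poly_Mapping.keys a. \<Sum>g\<in>Poly_Mapping.keys a. if g = f then
              cnj (Poly_Mapping.lookup a f) * Poly_Mapping.lookup a g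
                * exp (\<i> / 2 * complex_of_real (h * sympl f g)) else 0)"
      by (simp add: weyl_star_mult_expansion Poly_Mapping.lookup_sum lookup_weyl_gen
          if_distrib[of "(*) _"] cong: if_cong)
    also have "\<dots> = (\<Sum>f\<in>Poly_Mapping.keys a. complex_of_real ((cmod (Poly_Mapping.lookup a f))\<^sup>2))"
      by (simp add: complex_norm_square mult_ac del: of_real_power)
    finally show ?thesis by simp
  qed
  moreover have "Vector_Spaces.linear weyl_scale (*) (\<lambda>a :: 'a weyl. Poly_Mapping.lookup a 0)"
    by unfold_locales (simp_all add: Poly_Mapping.lookup_add algebra_simps)
  ultimately show ?thesis
    by (simp add: weyl_states_def weyl_one_def lookup_weyl_gen sum_nonneg del: of_real_sum)
qed

lemma weyl_states_gen_le_one: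
  assumes "\<omega> \<in> weyl_states h"
  shows "cmod (\<omega> (weyl_gen f)) \<le> 1"
proof -
  interpret \<omega>: Vector_Spaces.linear weyl_scale "(*)" \<omega>
    using assms by (simp add: weyl_states_def)
  define u v where "u = \<omega> (weyl_gen f)" and "v = \<omega> (weyl_gen (- f))"
  have pos: "2 + z * u + cnj z * v \<in> \<real>\<^sub>\<ge>\<^sub>0" if "cmod z = 1" for z
  proof -
    define a where "a = weyl_one + weyl_scale z (weyl_gen f)"
    have "weyl_mult h (weyl_star a) a =
            weyl_one + weyl_one + weyl_scale z (weyl_gen f) + weyl_scale (cnj z) (weyl_gen (- f))"
      using that complex_norm_square[of z]
      by (simp add: a_def weyl_one_def weyl_star_add weyl_star_scale weyl_star_gen
          weyl_mult_add_left weyl_mult_add_right weyl_mult_scale_left weyl_mult_scale_right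
          weyl_mult_gen weyl.scale_right_distrib mult_ac)
    then have "\<omega> (weyl_mult h (weyl_star a) a) = \<omega> weyl_one + \<omega> weyl_one + z * u + cnj z * v"
      by (simp only: \<omega>.add \<omega>.scale u_def v_def)
    moreover have "\<omega> (weyl_mult h (weyl_star a) a) \<in> \<real>\<^sub>\<ge>\<^sub>0" "\<omega> weyl_one = 1"
      using assms by (simp_all add: weyl_states_def)
    ultimately show ?thesis
      by simp
  qed
  have v: "v = cnj u"
    using pos[of 1] pos[of \<i>] by (auto simp: complex_nonneg_Reals_iff complex_eq_iff)
  show ?thesis
  proof (cases "u = 0")
    case False
    define z where "z = - cnj u / complex_of_real (cmod u)"
    have zu: "z * u = - complex_of_real (cmod u)"
      using False complex_norm_square[of u] by (simp add: z_def field_simps power2_eq_square)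
    then have "cnj z * v = - complex_of_real (cmod u)"
      unfolding v by (metis complex_cnj_complex_of_real complex_cnj_minus complex_cnj_mult)
    moreover have "cmod z = 1" using False by (simp add: z_def norm_divide)
    ultimately have "2 + - complex_of_real (cmod u) + - complex_of_real (cmod u) \<in> \<real>\<^sub>\<ge>\<^sub>0"
      using pos[of z] zu by metis
    then show ?thesis
      by (simp add: complex_nonneg_Reals_iff u_def)
  qed (simp add: u_def)
qed

lemma weyl_norm_bdd_above:
  "bdd_above ((\<lambda>\<omega>. sqrt (Re (\<omega> (weyl_mult h (weyl_star a) a)))) ` weyl_states h)"
proof -
  let ?S = "Poly_Mapping.keys a" and ?l = "Poly_Mapping.lookup a"
  have "sqrt (Re (\<omega> (weyl_mult h (weyl_star a) a))) \<le> sqrt (\<Sum>f\<in>?S. \<Sum>g\<in>?S. cmod (?l f) * cmod (?l g))"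
    if \<omega>: "\<omega> \<in> weyl_states h" for \<omega>
  proof -
    interpret \<omega>: Vector_Spaces.linear weyl_scale "(*)" \<omega>
      using \<omega> by (simp add: weyl_states_def)
    have "Re (\<omega> (weyl_mult h (weyl_star a) a)) \<le> cmod (\<omega> (weyl_mult h (weyl_star a) a))"
      by (rule complex_Re_le_cmod)
    also have "\<dots> \<le> (\<Sum>f\<in>?S. \<Sum>g\<in>?S. cmod (?l f) * cmod (?l g))"
      unfolding weyl_star_mult_expansion \<omega>.sum \<omega>.scale
      using weyl_states_gen_le_one[OF \<omega>]
      by (intro sum_norm_le) (simp add: norm_mult mult_left_le)
    finally show ?thesis by simp
  qed
  then show ?thesis by (rule bdd_aboveI2)
qed

end

theory Submission
  imports Defs
begin

text \<open>
  For a state \<open>\<omega>\<close> on the Weyl algebra at \<open>h\<close>, the Gaussian factor of \<open>Q\<^sub>h\<close> splits as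
  \<open>exp (- h / 4 * (norm (g - f))\<^sup>2) = d f * d g * exp (h / 2 * cinner g f) * exp (\<i> / 2 * h * sympl f g)\<close>,
  and the last factor is the one that makes \<open>\<omega> (W (g - f))\<close> a positive semidefinite kernel. Since
  \<open>exp (h / 2 * cinner g f) - 1\<close> is positive semidefinite as well, the Schur product theorem gives
  the Kadison-Schwarz inequality \<open>\<omega> (Q\<^sub>h(c)\<^sup>* Q\<^sub>h(c)) \<le> \<omega> (Q\<^sub>h(c\<^sup>* c))\<close>. Hence \<open>\<omega> \<circ> Q\<^sub>h\<close> is a state
  of the commutative algebra and \<open>Q\<^sub>h\<close> is a contraction. For positivity in the completion, an
  element on which all states are nonnegative is written as \<open>Z\<^sup>* Z\<close> by an iteration for the
  square root.
\<close>

section \<open>Positive semidefinite kernels\<close>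

definition psd_on :: "'i set \<Rightarrow> ('i \<Rightarrow> 'i \<Rightarrow> complex) \<Rightarrow> bool" where
  "psd_on S M \<longleftrightarrow> (\<forall>c. (\<Sum>i\<in>S. \<Sum>j\<in>S. cnj (c i) * c j * M i j) \<in> \<real>\<^sub>\<ge>\<^sub>0)"

lemma psd_onD: "psd_on S M \<Longrightarrow> (\<Sum>i\<in>S. \<Sum>j\<in>S. cnj (c i) * c j * M i j) \<in> \<real>\<^sub>\<ge>\<^sub>0"
  by (simp add: psd_on_def)

lemma cnj_mult_nonneg: "cnj z * z \<in> \<real>\<^sub>\<ge>\<^sub>0"
  by (simp add: complex_nonneg_Reals_iff)

section \<open>Restriction, Hermitian symmetry and Schur complements\<close>

lemma psd_on_subset:
  assumes M: "psd_on S M" and "T \<subseteq> S" "finite S"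
  shows "psd_on T M"
  unfolding psd_on_def
proof
  fix c :: "'a \<Rightarrow> complex"
  let ?c = "\<lambda>i. if i \<in> T then c i else 0"
  have "(\<Sum>i\<in>S. \<Sum>j\<in>S. cnj (?c i) * ?c j * M i j) = (\<Sum>i\<in>T. \<Sum>j\<in>T. cnj (?c i) * ?c j * M i j)"
    using assms(2,3) by (intro sum.mono_neutral_cong_right ballI) auto
  also have "\<dots> = (\<Sum>i\<in>T. \<Sum>j\<in>T. cnj (c i) * c j * M i j)"
    by (intro sum.cong refl) auto
  finally show "(\<Sum>i\<in>T. \<Sum>j\<in>T. cnj (c i) * c j * M i j) \<in> \<real>\<^sub>\<ge>\<^sub>0"
    using psd_onD[OF M, of ?c] by (simp only:)
qed

lemma psd_on_diag:
  assumes "psd_on S M" "finite S" "a \<in> S"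
  shows "M a a \<in> \<real>\<^sub>\<ge>\<^sub>0"
  using psd_onD[OF psd_on_subset[OF assms(1), of "{a}"], of "\<lambda>_. 1"] assms(2,3) by simp

lemma psd_on_two:
  assumes "psd_on S M" "finite S" "a \<in> S" "b \<in> S" "a \<noteq> b"
  shows "cnj x * x * M a a + cnj x * y * M a b + (cnj y * x * M b a + cnj y * y * M b b) \<in> \<real>\<^sub>\<ge>\<^sub>0"
  using psd_onD[OF psd_on_subset[OF assms(1), of "{a, b}"], of "\<lambda>i. if i = a then x else y"] assms(2-)
  by (simp add: add.assoc)

text \<open>On the vectors with entries \<open>1, 1\<close> and \<open>1, \<i>\<close> at
  \<open>a, b\<close>, real values of the form make \<open>M a b + M b a\<close> and
  \<open>\<i> * (M a b - M b a)\<close> real, since the diagonal is real.\<close>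

lemma psd_on_hermitian:
  assumes "psd_on S M" "finite S" "a \<in> S" "b \<in> S"
  shows "M b a = cnj (M a b)"
proof (cases "a = b")
  case True
  then show ?thesis
    using psd_on_diag[OF assms(1-3)] by (simp add: complex_nonneg_Reals_iff complex_eq_iff)
next
  case False
  show ?thesis
    using psd_on_two[OF assms False, of 1 1] psd_on_two[OF assms False, of 1 \<i>]
      psd_on_diag[OF assms(1-3)] psd_on_diag[OF assms(1,2,4)]
    by (simp add: complex_nonneg_Reals_iff complex_eq_iff)
qed

text \<open>On the vector with entries \<open>- t * M a b\<close> and \<open>1\<close> at
  \<open>a\<close> and \<open>b\<close>, the form is \<open>M b b\<close> minus \<open>2 * t\<close>
  times the squared modulus of \<open>M a b\<close>, which is negative for large
  \<open>t\<close>.\<close>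

lemma psd_on_zero_diag:
  assumes "psd_on S M" "finite S" "a \<in> S" "b \<in> S" "M a a = 0"
  shows "M a b = 0"
proof (rule ccontr)
  assume nz: "M a b \<noteq> 0"
  with assms(5) have "a \<noteq> b" by auto
  \<comment> \<open>Chosen so that the form takes the value \<open>-1\<close>.\<close>
  define t where "t = (Re (M b b) + 1) / (2 * (cmod (M a b))\<^sup>2)"
  have "Re (cnj (- of_real t * M a b) * M a b + (- of_real t * M a b) * cnj (M a b) + M b b) \<ge> 0"
    using psd_on_two[OF assms(1-4) \<open>a \<noteq> b\<close>, of "- of_real t * M a b" 1] assms(5)
      psd_on_hermitian[OF assms(1-4)]
    by (simp add: complex_nonneg_Reals_iff)
  then have "Re (M b b) - 2 * t * (cmod (M a b))\<^sup>2 \<ge> 0"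
    unfolding cmod_power2 by (simp add: power2_eq_square algebra_simps)
  moreover have "2 * t * (cmod (M a b))\<^sup>2 = Re (M b b) + 1"
    using nz by (simp add: t_def)
  ultimately show False by simp
qed

text \<open>If \<open>M a a = 0\<close>, division by zero makes the correction term vanish.\<close>

lemma psd_on_schur_complement:
  assumes M: "psd_on (insert a S) M" and S: "finite S" "a \<notin> S"
  shows "psd_on S (\<lambda>i j. M i j - M i a * M a j / M a a)"
proof (cases "M a a = 0")
  case True
  then show ?thesis
    using psd_on_subset[OF M, of S] S by auto
next
  case False
  have fin: "finite (insert a S)" using S by simp
  show ?thesis
    unfolding psd_on_def
  proof
    fix c :: "'a \<Rightarrow> complex"
    define B where "B = (\<Sum>j\<in>S. c j * M a j)"
    \<comment> \<open>Completing the square: with the other entries fixed at \<open>c\<close>, the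
      form is minimal for this entry at \<open>a\<close>.\<close>
    define c' where "c' = (\<lambda>i. if i = a then - B / M a a else c i)"
    have cB: "cnj B = (\<Sum>i\<in>S. cnj (c i) * M i a)"
      unfolding B_def using psd_on_hermitian[OF M fin, of a] by simp
    have cM: "cnj (M a a) = M a a"
      using psd_on_hermitian[OF M fin, of a a] by simp
    have "(\<Sum>i\<in>insert a S. \<Sum>j\<in>insert a S. cnj (c' i) * c' j * M i j) =
        cnj (c' a) * c' a * M a a + cnj (c' a) * (\<Sum>j\<in>S. c' j * M a j)
        + (\<Sum>i\<in>S. cnj (c' i) * M i a) * c' a + (\<Sum>i\<in>S. \<Sum>j\<in>S. cnj (c' i) * c' j * M i j)"
      using S by (simp add: sum.distrib sum_distrib_left sum_distrib_right mult_ac)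
    also have "(\<Sum>j\<in>S. c' j * M a j) = B"
      unfolding B_def using S by (intro sum.cong) (auto simp: c'_def)
    also have "(\<Sum>i\<in>S. cnj (c' i) * M i a) = cnj B"
      unfolding cB using S by (intro sum.cong) (auto simp: c'_def)
    also have "(\<Sum>i\<in>S. \<Sum>j\<in>S. cnj (c' i) * c' j * M i j) = (\<Sum>i\<in>S. \<Sum>j\<in>S. cnj (c i) * c j * M i j)"
      using S by (intro sum.cong) (auto simp: c'_def)
    also have "cnj (c' a) * c' a * M a a + cnj (c' a) * B + cnj B * c' a
        = - (cnj B * B / M a a)"
      using False by (simp add: c'_def cM field_simps)
    also have "\<dots> = - (\<Sum>i\<in>S. \<Sum>j\<in>S. cnj (c i) * c j * (M i a * M a j / M a a))"
      unfolding cB unfolding B_def sum_product sum_divide_distrib by (simp add: mult_ac)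
    finally show "(\<Sum>i\<in>S. \<Sum>j\<in>S. cnj (c i) * c j * (M i j - M i a * M a j / M a a)) \<in> \<real>\<^sub>\<ge>\<^sub>0"
      using psd_onD[OF M, of c'] by (simp add: right_diff_distrib sum_subtractf)
  qed
qed

text \<open>For \<open>M a a > 0\<close> this is nonnegativity of the Schur complement of
  \<open>a\<close> in the block on \<open>{a, b}\<close>; for \<open>M a a = 0\<close> the entry
  \<open>M a b\<close> vanishes.\<close>

lemma psd_on_cauchy_schwarz:
  assumes M: "psd_on S M" and S: "finite S" "a \<in> S" "b \<in> S"
  shows "(cmod (M a b))\<^sup>2 \<le> Re (M a a) * Re (M b b)"
proof (cases "a = b")
  case True
  then show ?thesis
    using psd_on_diag[OF M S(1,2)]
    by (auto elim!: nonneg_Reals_cases simp: power2_eq_square)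
next
  case False
  obtain p where p: "M a a = of_real p" "p \<ge> 0"
    using psd_on_diag[OF M S(1,2)] by (auto elim!: nonneg_Reals_cases)
  show ?thesis
  proof (cases "p = 0")
    case True
    then show ?thesis
      using psd_on_zero_diag[OF M S] p by simp
  next
    case nz: False
    have "psd_on {b} (\<lambda>i j. M i j - M i a * M a j / M a a)"
      using psd_on_schur_complement[of a "{b}" M] psd_on_subset[OF M, of "{a, b}"] S False by simp
    then have "M b b - M b a * M a b / M a a \<in> \<real>\<^sub>\<ge>\<^sub>0"
      using psd_on_diag by fastforce
    then have "Re (M b b - of_real ((cmod (M a b))\<^sup>2 / p)) \<ge> 0"
      using psd_on_hermitian[OF M S] complex_norm_square[of "M a b"] p
      by (simp add: complex_nonneg_Reals_iff mult.commute)
    then show ?thesis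
      using p nz by (simp add: field_simps)
  qed
qed

text \<open>This is the Schur product theorem with the coefficients absorbed into \<open>M\<close>.
  A rank one kernel \<open>R\<close> is split off: its pairing with \<open>N\<close> is a
  nonnegative multiple of a value of the form of \<open>N\<close>, and \<open>M - R\<close> lives on
  \<open>S\<close>, where it is a Schur complement. The induction therefore has to leave
  \<open>M\<close> arbitrary.\<close>

lemma psd_on_trace_nonneg:
  assumes "finite S" "psd_on S M" "psd_on S N"
  shows "(\<Sum>i\<in>S. \<Sum>j\<in>S. M i j * N i j) \<in> \<real>\<^sub>\<ge>\<^sub>0"
  using assms
proof (induction S arbitrary: M rule: finite_induct)
  case (insert a S)
  let ?T = "insert a S"
  \<comment> \<open>The rank one part carrying row and column \<open>a\<close>; it is
    \<open>0\<close> when \<open>M a a = 0\<close>, by division by zero.\<close>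
  define R where "R = (\<lambda>i j. M i a * M a j / M a a)"
  note her = psd_on_hermitian[OF insert.prems(1)]
  obtain p where p: "M a a = of_real p" "p \<ge> 0"
    using psd_on_diag[OF insert.prems(1)] insert.hyps(1) by (auto elim!: nonneg_Reals_cases)
  \<comment> \<open>If \<open>M a a = 0\<close>, then \<open>R\<close> is zero and row and column
    \<open>a\<close> of \<open>M\<close> vanish by positivity.\<close>
  have zero: "M i a - R i a = 0 \<and> M a i - R a i = 0" if "i \<in> ?T" for i
    using psd_on_zero_diag[OF insert.prems(1), of a i] her[of a i] insert.hyps(1) that
    by (cases "M a a = 0") (auto simp: R_def)
  have "(\<Sum>i\<in>?T. \<Sum>j\<in>?T. R i j * N i j)
      = of_real (1 / p) * (\<Sum>i\<in>?T. \<Sum>j\<in>?T. cnj (M a i) * M a j * N i j)"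
    unfolding sum_distrib_left
  proof (intro sum.cong refl)
    fix i j assume "i \<in> ?T"
    then have "M i a = cnj (M a i)" using her[of a i] insert.hyps(1) by simp
    then show "R i j * N i j = of_real (1 / p) * (cnj (M a i) * M a j * N i j)"
      unfolding R_def p(1) by simp
  qed
  also have "\<dots> \<in> \<real>\<^sub>\<ge>\<^sub>0"
    using p by (intro nonneg_Reals_mult_I psd_onD insert.prems) simp
  finally have 1: "(\<Sum>i\<in>?T. \<Sum>j\<in>?T. R i j * N i j) \<in> \<real>\<^sub>\<ge>\<^sub>0" .
  have "(\<Sum>i\<in>?T. \<Sum>j\<in>?T. (M i j - R i j) * N i j) = (\<Sum>i\<in>S. \<Sum>j\<in>S. (M i j - R i j) * N i j)"
    using insert.hyps zero by simp
  also have "\<dots> \<in> \<real>\<^sub>\<ge>\<^sub>0"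
    using insert.IH[of "\<lambda>i j. M i j - R i j"] insert.hyps insert.prems
      psd_on_schur_complement[of a S M] psd_on_subset[of ?T N S]
    by (auto simp: R_def)
  finally have "(\<Sum>i\<in>?T. \<Sum>j\<in>?T. R i j * N i j) + (\<Sum>i\<in>?T. \<Sum>j\<in>?T. (M i j - R i j) * N i j) \<in> \<real>\<^sub>\<ge>\<^sub>0"
    using 1 nonneg_Reals_add_I by blast
  then show ?case
    by (simp add: sum.distrib[symmetric] algebra_simps)
qed simp

section \<open>Operations that preserve positive semidefiniteness\<close>

lemma psd_on_scale:
  assumes "psd_on S M"
  shows "psd_on S (\<lambda>i j. cnj (d i) * d j * M i j)"
  unfolding psd_on_def
proof
  fix c
  show "(\<Sum>i\<in>S. \<Sum>j\<in>S. cnj (c i) * c j * (cnj (d i) * d j * M i j)) \<in> \<real>\<^sub>\<ge>\<^sub>0"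
    using psd_onD[OF assms, of "\<lambda>i. c i * d i"] by (simp add: mult_ac)
qed

lemma psd_on_schur_product:
  assumes "finite S" "psd_on S M" "psd_on S N"
  shows "psd_on S (\<lambda>i j. M i j * N i j)"
  unfolding psd_on_def
proof
  fix c
  show "(\<Sum>i\<in>S. \<Sum>j\<in>S. cnj (c i) * c j * (M i j * N i j)) \<in> \<real>\<^sub>\<ge>\<^sub>0"
    using psd_on_trace_nonneg[OF assms(1) psd_on_scale[OF assms(2), of c] assms(3)]
    by (simp only: mult.assoc)
qed

lemma psd_on_add:
  assumes "psd_on S M" "psd_on S N"
  shows "psd_on S (\<lambda>i j. M i j + N i j)"
  unfolding psd_on_def
proof
  fix c
  show "(\<Sum>i\<in>S. \<Sum>j\<in>S. cnj (c i) * c j * (M i j + N i j)) \<in> \<real>\<^sub>\<ge>\<^sub>0"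
    using nonneg_Reals_add_I[OF assms[THEN psd_onD, of c]]
    by (simp only: distrib_left sum.distrib)
qed

lemma psd_on_one: "psd_on S (\<lambda>_ _. 1)"
  unfolding psd_on_def
proof
  fix c :: "'a \<Rightarrow> complex"
  have "(\<Sum>i\<in>S. \<Sum>j\<in>S. cnj (c i) * c j * 1) = cnj (sum c S) * sum c S"
    by (simp add: sum_product)
  then show "(\<Sum>i\<in>S. \<Sum>j\<in>S. cnj (c i) * c j * 1) \<in> \<real>\<^sub>\<ge>\<^sub>0"
    using cnj_mult_nonneg by metis
qed

lemma psd_on_cmult:
  assumes "psd_on S M" "r \<in> \<real>\<^sub>\<ge>\<^sub>0"
  shows "psd_on S (\<lambda>i j. r * M i j)"
  unfolding psd_on_def
proof
  fix c
  show "(\<Sum>i\<in>S. \<Sum>j\<in>S. cnj (c i) * c j * (r * M i j)) \<in> \<real>\<^sub>\<ge>\<^sub>0"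
    using nonneg_Reals_mult_I[OF assms(2) psd_onD[OF assms(1), of c]]
    by (simp add: sum_distrib_left mult_ac)
qed

lemma psd_on_power:
  assumes "finite S" "psd_on S M"
  shows "psd_on S (\<lambda>i j. M i j ^ k)"
  by (induction k) (simp_all add: psd_on_one psd_on_schur_product assms)

lemma psd_on_sum:
  assumes "\<And>k. k \<in> K \<Longrightarrow> psd_on S (F k)"
  shows "psd_on S (\<lambda>i j. \<Sum>k\<in>K. F k i j)"
  using assms
proof (induction K rule: infinite_finite_induct)
  case (insert k K)
  then show ?case using psd_on_add[of S "F k"] by simp
qed (simp_all add: psd_on_def)

lemma psd_on_lim:
  assumes "\<And>n::nat. psd_on S (F n)" "\<And>i j. (\<lambda>n. F n i j) \<longlonglongrightarrow> M i j"
  shows "psd_on S M"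
  unfolding psd_on_def
proof
  fix c
  have "(\<lambda>n. \<Sum>i\<in>S. \<Sum>j\<in>S. cnj (c i) * c j * F n i j) \<longlonglongrightarrow> (\<Sum>i\<in>S. \<Sum>j\<in>S. cnj (c i) * c j * M i j)"
    by (intro tendsto_intros assms)
  then show "(\<Sum>i\<in>S. \<Sum>j\<in>S. cnj (c i) * c j * M i j) \<in> \<real>\<^sub>\<ge>\<^sub>0"
    by (rule closed_sequentially[OF closed_nonneg_Reals_complex psd_onD[OF assms(1)]])
qed

text \<open>Without its constant term the exponential series still has nonnegative coefficients.
  Entrywise powers are positive by the Schur product theorem, and positivity passes to sums and
  pointwise limits.\<close>

lemma psd_on_exp_minus_one:
  assumes "finite S" "psd_on S M"
  shows "psd_on S (\<lambda>i j. exp (M i j) - 1)"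
proof (rule psd_on_lim)
  show "psd_on S (\<lambda>i j. \<Sum>k<n. of_real (inverse (fact (Suc k))) * M i j ^ Suc k)" for n
    by (intro psd_on_sum psd_on_cmult psd_on_power assms nonneg_Reals_of_real_iff[THEN iffD2]) simp
  fix i j
  have "(\<lambda>k. M i j ^ k /\<^sub>R fact k) sums exp (M i j)"
    by (rule exp_converges)
  then have "(\<lambda>k. M i j ^ Suc k /\<^sub>R fact (Suc k)) sums (exp (M i j) - 1)"
    using sums_Suc_iff[of "\<lambda>k. M i j ^ k /\<^sub>R fact k" "exp (M i j) - 1"]
    by (simp del: fact_Suc power_Suc)
  then show "(\<lambda>n. \<Sum>k<n. of_real (inverse (fact (Suc k))) * M i j ^ Suc k) \<longlonglongrightarrow> exp (M i j) - 1"
    by (simp add: sums_def scaleR_conv_of_real del: fact_Suc power_Suc)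
qed

section \<open>The Gram kernel of the inner product\<close>

lemma cinner_scaleC_left: "cinner (a *\<^sub>C x) y = cnj a * cinner x y"
  by (subst (1 2) cinner_commute) (simp add: cinner_scaleC_right)

lemma cinner_zero [simp]: "cinner x 0 = 0" "cinner 0 x = 0"
  using cinner_add_right[of x 0 0] cinner_add_left[of 0 0 x] by simp_all

lemma cinner_sum_right: "cinner x (sum F I) = (\<Sum>i\<in>I. cinner x (F i))"
  by (induction I rule: infinite_finite_induct) (simp_all add: cinner_add_right)

lemma cinner_sum_left: "cinner (sum F I) x = (\<Sum>i\<in>I. cinner (F i) x)"
  by (induction I rule: infinite_finite_induct) (simp_all add: cinner_add_left)

text \<open>The form is the squared norm of \<open>?v\<close>. The conjugated coefficients in
  \<open>?v\<close> match the swapped arguments of \<open>cinner g f\<close>, as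
  \<open>cinner\<close> is linear in its second argument.\<close>

lemma psd_on_cinner: "psd_on S (\<lambda>f g. cinner g f)"
  unfolding psd_on_def
proof
  fix c :: "'a \<Rightarrow> complex"
  let ?v = "\<Sum>f\<in>S. cnj (c f) *\<^sub>C f"
  have "(\<Sum>f\<in>S. \<Sum>g\<in>S. cnj (c f) * c g * cinner g f) = cinner ?v ?v"
    by (simp add: cinner_sum_left cinner_sum_right cinner_scaleC_left cinner_scaleC_right
        sum_distrib_left mult_ac)
  then show "(\<Sum>f\<in>S. \<Sum>g\<in>S. cnj (c f) * c g * cinner g f) \<in> \<real>\<^sub>\<ge>\<^sub>0"
    by (simp add: cinner_self)
qed

section \<open>States and the quantization map\<close>

locale weyl_state =
  fixes h :: real and \<omega> :: "'a::complex_hilbert_space weyl \<Rightarrow> complex"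
  assumes state: "\<omega> \<in> weyl_states h"
begin

sublocale Vector_Spaces.linear weyl_scale "(*)" \<omega>
  using state by (simp add: weyl_states_def)

lemma one [simp]: "\<omega> weyl_one = 1"
  using state by (simp add: weyl_states_def)

lemma nonneg: "\<omega> (weyl_mult h (weyl_star a) a) \<in> \<real>\<^sub>\<ge>\<^sub>0"
  using state by (simp add: weyl_states_def)

text \<open>The form at \<open>c\<close> is \<open>\<omega> (a\<^sup>* a)\<close> for the linear
  combination \<open>a\<close> of the \<open>A i\<close> with coefficients
  \<open>c i\<close>.\<close>

lemma psd: "psd_on S (\<lambda>i j. \<omega> (weyl_mult h (weyl_star (A i)) (A j)))"
  unfolding psd_on_def
proof
  fix c
  let ?a = "\<Sum>i\<in>S. weyl_scale (c i) (A i)"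
  have "weyl_mult h (weyl_star ?a) ?a =
     (\<Sum>i\<in>S. \<Sum>j\<in>S. weyl_scale (cnj (c i) * c j) (weyl_mult h (weyl_star (A i)) (A j)))"
    by (simp add: weyl_star_sum weyl_mult_sum_left weyl_mult_sum_right weyl_star_scale
        weyl_mult_scale_left weyl_mult_scale_right weyl.scale_sum_right)
       (subst sum.swap, simp add: mult_ac)
  then show "(\<Sum>i\<in>S. \<Sum>j\<in>S. cnj (c i) * c j * \<omega> (weyl_mult h (weyl_star (A i)) (A j))) \<in> \<real>\<^sub>\<ge>\<^sub>0"
    using nonneg[of ?a] by (simp add: sum scale)
qed

lemma cauchy_schwarz:
  "(cmod (\<omega> (weyl_mult h (weyl_star a) b)))\<^sup>2
    \<le> Re (\<omega> (weyl_mult h (weyl_star a) a)) * Re (\<omega> (weyl_mult h (weyl_star b) b))"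
  using psd_on_cauchy_schwarz[OF psd[of "{a, b}" "\<lambda>x. x"], of a b] by simp

end

section \<open>The Gaussian factor and the Kadison-Schwarz inequality\<close>

lemma weyl_star_one [simp]: "weyl_star weyl_one = weyl_one"
  by (simp add: weyl_one_def weyl_star_gen)

text \<open>Expanding the squared norm leaves \<open>h / 2 * Re (cinner g f)\<close> in the
  exponent, and \<open>Re (cinner g f) = cinner g f + \<i> * sympl f g\<close>. The last factor is
  exactly the phase of \<open>W(f)\<^sup>* W(g)\<close> in the Weyl algebra at
  \<open>h\<close>.\<close>

lemma exp_norm_diff_eq:
  fixes f g :: "'a::complex_hilbert_space"
  shows "complex_of_real (exp (- (h / 4) * (norm (g - f))\<^sup>2)) =
    of_real (exp (- (h / 4) * (norm f)\<^sup>2)) * of_real (exp (- (h / 4) * (norm g)\<^sup>2))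
    * exp (of_real (h / 2) * cinner g f) * exp (\<i> / 2 * complex_of_real (h * sympl f g))"
proof -
  have 1: "cinner (- x) y = - cinner x y" "cinner y (- x) = - cinner y x" for x y :: 'a
    using cinner_add_left[of x "- x" y] cinner_add_right[of y x "- x"]
    by (simp_all add: eq_neg_iff_add_eq_0 add.commute)
  have "complex_of_real ((norm (g - f))\<^sup>2) = cinner (g + - f) (g + - f)"
    by (simp add: cinner_self)
  also have "\<dots> = cinner g g + cinner f f - (cinner g f + cnj (cinner g f))"
    unfolding cinner_add_left cinner_add_right 1 by (subst cinner_commute[of f g]) simp
  finally have n: "(norm (g - f))\<^sup>2 = (norm g)\<^sup>2 + (norm f)\<^sup>2 - 2 * Re (cinner g f)"
    by (simp add: cinner_self complex_eq_iff)
  have im: "Im (cinner g f) = - sympl f g"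
    using sympl_commute[of g f] by (simp add: sympl_def)
  have "complex_of_real (- (h / 4) * (norm (g - f))\<^sup>2) =
      of_real (- (h / 4) * (norm f)\<^sup>2) + of_real (- (h / 4) * (norm g)\<^sup>2)
      + of_real (h / 2) * cinner g f + \<i> / 2 * complex_of_real (h * sympl f g)"
    unfolding n by (simp add: complex_eq_iff im algebra_simps)
  from arg_cong[OF this, of exp] show ?thesis
    by (simp only: exp_add exp_of_real)
qed

text \<open>With free coefficients in place of those read off the keys, the expansion applies
  directly to \<open>weyl_quant h c\<close>.\<close>

lemma weyl_star_mult_sum:
  "weyl_mult h (weyl_star (\<Sum>f\<in>S. weyl_scale (c f) (weyl_gen f))) (\<Sum>f\<in>S. weyl_scale (c f) (weyl_gen f)) =
     (\<Sum>f\<in>S. \<Sum>g\<in>S. weyl_scale (cnj (c f) * c g * exp (\<i> / 2 * complex_of_real (h * sympl f g)))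
          (weyl_gen (g - f)))"
  by (simp add: weyl_star_sum weyl_mult_sum_left weyl_mult_sum_right weyl_star_scale
        weyl_mult_scale_left weyl_mult_scale_right weyl.scale_sum_right weyl_star_gen weyl_mult_gen)
     (subst sum.swap, simp add: mult_ac)

interpretation weyl_quant: Vector_Spaces.linear weyl_scale weyl_scale "weyl_quant h"
  by (rule linear_weyl_quant)

text \<open>
  The difference is the Schur product of the positive kernel of \<open>\<omega>\<close> with
  \<open>d f * d g * (exp (h / 2 * cinner g f) - 1)\<close>, where \<open>d f = exp (- h / 4 * (norm f)\<^sup>2)\<close>.
\<close>

lemma weyl_quant_kadison_schwarz:
  assumes "\<omega> \<in> weyl_states h" and h: "0 \<le> h"
  shows "\<omega> (weyl_quant h (weyl_mult 0 (weyl_star c) c))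
       - \<omega> (weyl_mult h (weyl_star (weyl_quant h c)) (weyl_quant h c)) \<in> \<real>\<^sub>\<ge>\<^sub>0"
proof -
  interpret weyl_state h \<omega> by unfold_locales fact
  define d where "d f = complex_of_real (exp (- (h / 4) * (norm f)\<^sup>2))" for f :: 'a
  define E where "E f g = exp (\<i> / 2 * complex_of_real (h * sympl f g))" for f g :: 'a
  define K where "K f g = exp (of_real (h / 2) * cinner g f)" for f g :: 'a
  let ?S = "Poly_Mapping.keys c" and ?l = "Poly_Mapping.lookup c"
  \<comment> \<open>At parameter \<open>0\<close> the product has no phase, so the quantization just
    attaches \<open>d (g - f)\<close> to each term.\<close>
  have "\<omega> (weyl_quant h (weyl_mult 0 (weyl_star c) c))
      = (\<Sum>f\<in>?S. \<Sum>g\<in>?S. cnj (?l f) * ?l g * (d (g - f) * \<omega> (weyl_gen (g - f))))"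
    by (simp add: weyl_star_mult_expansion weyl_quant.sum weyl_quant.scale weyl_quant_gen
        sum scale d_def mult.assoc)
  also have "\<dots> = (\<Sum>f\<in>?S. \<Sum>g\<in>?S. cnj (?l f) * ?l g * (d f * d g * K f g * E f g * \<omega> (weyl_gen (g - f))))"
    unfolding d_def K_def E_def exp_norm_diff_eq ..
  finally have 1: "\<omega> (weyl_quant h (weyl_mult 0 (weyl_star c) c)) = \<dots>" .
  have q: "weyl_quant h c = (\<Sum>f\<in>?S. weyl_scale (?l f * d f) (weyl_gen f))"
    by (simp add: weyl_quant_def d_def)
  have "\<omega> (weyl_mult h (weyl_star (weyl_quant h c)) (weyl_quant h c))
      = (\<Sum>f\<in>?S. \<Sum>g\<in>?S. cnj (?l f) * ?l g * (d f * d g * E f g * \<omega> (weyl_gen (g - f))))"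
    unfolding q weyl_star_mult_sum by (simp add: sum scale E_def d_def mult_ac)
  \<comment> \<open>As \<open>d\<close> is real, conjugating \<open>d f\<close> changes nothing; it
    gives the second factor the shape of \<open>psd_on_scale\<close>.\<close>
  with 1 have 2: "\<omega> (weyl_quant h (weyl_mult 0 (weyl_star c) c))
       - \<omega> (weyl_mult h (weyl_star (weyl_quant h c)) (weyl_quant h c))
     = (\<Sum>f\<in>?S. \<Sum>g\<in>?S. cnj (?l f) * ?l g *
          ((E f g * \<omega> (weyl_gen (g - f))) * (cnj (d f) * d g * (K f g - 1))))"
    by (simp add: sum_subtractf[symmetric] algebra_simps d_def)
  have "psd_on ?S (\<lambda>f g. \<omega> (weyl_mult h (weyl_star (weyl_gen f)) (weyl_gen g)))"
    by (rule psd)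
  then have "psd_on ?S (\<lambda>f g. E f g * \<omega> (weyl_gen (g - f)))"
    by (simp add: weyl_star_gen weyl_mult_gen scale E_def)
  moreover have "psd_on ?S (\<lambda>f g. cnj (d f) * d g * (K f g - 1))"
    \<comment> \<open>Here \<open>0 \<le> h\<close> enters: the Gram kernel is scaled by
      \<open>h / 2\<close> before exponentiation.\<close>
    unfolding K_def using h by (intro psd_on_scale psd_on_exp_minus_one psd_on_cmult psd_on_cinner) auto
  ultimately show ?thesis
    unfolding 2 by (intro psd_onD[OF psd_on_schur_product[OF finite_keys]])
qed

text \<open>The value is the Kadison-Schwarz difference plus
  \<open>\<omega> (Q\<^sub>h(c)\<^sup>* Q\<^sub>h(c))\<close>, both nonnegative.\<close>

lemma weyl_quant_nonneg:
  assumes "\<omega> \<in> weyl_states h" "0 \<le> h"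
  shows "\<omega> (weyl_quant h (weyl_mult 0 (weyl_star c) c)) \<in> \<real>\<^sub>\<ge>\<^sub>0"
proof -
  interpret weyl_state h \<omega> by unfold_locales fact
  show ?thesis
    using nonneg_Reals_add_I[OF weyl_quant_kadison_schwarz[OF assms, of c] nonneg[of "weyl_quant h c"]] by simp
qed

lemma weyl_quant_state:
  assumes "\<omega> \<in> weyl_states h" "0 \<le> h"
  shows "(\<lambda>a. \<omega> (weyl_quant h a)) \<in> weyl_states 0"
proof -
  interpret weyl_state h \<omega> by unfold_locales fact
  have "Vector_Spaces.linear weyl_scale (*) (\<lambda>a. \<omega> (weyl_quant h a))"
    by unfold_locales (simp_all add: weyl_quant.add weyl_quant.scale add scale algebra_simps)
  moreover have "\<omega> (weyl_quant h weyl_one) = 1"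
    using one by (simp add: weyl_one_def weyl_quant_gen)
  ultimately show ?thesis
    using weyl_quant_nonneg[OF assms] by (simp add: weyl_states_def)
qed

text \<open>The Gaussian factors are real and even in \<open>f\<close>.\<close>

lemma weyl_star_quant: "weyl_star (weyl_quant h a) = weyl_quant h (weyl_star a)"
  by (induction a rule: weyl_induct)
     (simp_all add: weyl_quant.add weyl_quant.scale weyl_star_add weyl_star_scale
        weyl_quant_gen weyl_star_gen mult_ac)

section \<open>The norm is a $C^*$-seminorm\<close>

lemma weyl_norm_upper:
  assumes "\<omega> \<in> weyl_states h"
  shows "sqrt (Re (\<omega> (weyl_mult h (weyl_star a) a))) \<le> weyl_norm h a"
  unfolding weyl_norm_def by (rule cSUP_upper[OF assms weyl_norm_bdd_above])

lemma weyl_norm_nonneg [simp]: "0 \<le> weyl_norm h a"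
proof -
  \<comment> \<open>Any state gives the lower bound; the coefficient at \<open>0\<close> is one for
    every \<open>h\<close>.\<close>
  interpret weyl_state h "\<lambda>a. Poly_Mapping.lookup a 0"
    by unfold_locales (rule weyl_states_nonempty)
  show ?thesis
    using weyl_norm_upper[OF state, of a] nonneg[of a]
    by (meson complex_nonneg_Reals_iff order_trans real_sqrt_ge_zero)
qed

lemma weyl_norm_sq_upper:
  assumes "\<omega> \<in> weyl_states h"
  shows "Re (\<omega> (weyl_mult h (weyl_star a) a)) \<le> (weyl_norm h a)\<^sup>2"
  using weyl_norm_upper[OF assms] by (rule sqrt_le_D)

lemma weyl_norm_least:
  assumes "\<And>\<omega>. \<omega> \<in> weyl_states h \<Longrightarrow> Re (\<omega> (weyl_mult h (weyl_star a) a)) \<le> r\<^sup>2" "0 \<le> r"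
  shows "weyl_norm h a \<le> r"
  unfolding weyl_norm_def
  using assms weyl_states_nonempty by (intro cSUP_least) (auto intro: real_le_lsqrt)

text \<open>For each state \<open>\<omega>\<close> at \<open>h\<close>, Kadison-Schwarz bounds
  \<open>\<omega> (Q\<^sub>h(c)\<^sup>* Q\<^sub>h(c))\<close> by the value at
  \<open>c\<^sup>* c\<close> of the pulled back functional, which is a state at
  \<open>0\<close>.\<close>

lemma weyl_norm_quant_le:
  assumes "0 \<le> h"
  shows "weyl_norm h (weyl_quant h c) \<le> weyl_norm 0 c"
proof (rule weyl_norm_least)
  fix \<omega> :: "'a weyl \<Rightarrow> complex" assume \<omega>: "\<omega> \<in> weyl_states h"
  have "Re (\<omega> (weyl_mult h (weyl_star (weyl_quant h c)) (weyl_quant h c)))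
      \<le> Re (\<omega> (weyl_quant h (weyl_mult 0 (weyl_star c) c)))"
    using weyl_quant_kadison_schwarz[OF \<omega> assms, of c] by (simp add: complex_nonneg_Reals_iff)
  also have "\<dots> \<le> (weyl_norm 0 c)\<^sup>2"
    using weyl_norm_sq_upper[OF weyl_quant_state[OF \<omega> assms]] .
  finally show "Re (\<omega> (weyl_mult h (weyl_star (weyl_quant h c)) (weyl_quant h c))) \<le> (weyl_norm 0 c)\<^sup>2" .
qed simp

lemma cmod_weyl_form_le:
  assumes "\<omega> \<in> weyl_states h"
  shows "cmod (\<omega> (weyl_mult h (weyl_star a) b)) \<le> weyl_norm h a * weyl_norm h b"
proof -
  interpret weyl_state h \<omega> by unfold_locales fact
  have "(cmod (\<omega> (weyl_mult h (weyl_star a) b)))\<^sup>2 \<le> (weyl_norm h a)\<^sup>2 * (weyl_norm h b)\<^sup>2"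
    using nonneg[of a] nonneg[of b]
    by (intro order_trans[OF cauchy_schwarz] mult_mono weyl_norm_sq_upper assms)
       (auto simp: complex_nonneg_Reals_iff)
  then show ?thesis
    by (simp add: power_mult_distrib[symmetric] power2_le_iff_abs_le)
qed

lemma weyl_norm_one_le: "weyl_norm h weyl_one \<le> 1"
proof (rule weyl_norm_least)
  fix \<omega> :: "'a weyl \<Rightarrow> complex" assume "\<omega> \<in> weyl_states h"
  then interpret weyl_state h \<omega> by unfold_locales
  show "Re (\<omega> (weyl_mult h (weyl_star weyl_one) weyl_one)) \<le> 1\<^sup>2" by simp
qed simp

lemma cmod_weyl_state_le:
  assumes "\<omega> \<in> weyl_states h"
  shows "cmod (\<omega> a) \<le> weyl_norm h a"
  using order_trans[OF cmod_weyl_form_le[OF assms, of weyl_one a]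
      mult_right_mono[OF weyl_norm_one_le weyl_norm_nonneg]]
  by simp

lemma weyl_norm_add: "weyl_norm h (a + b) \<le> weyl_norm h a + weyl_norm h b"
proof (rule weyl_norm_least)
  fix \<omega> :: "'a weyl \<Rightarrow> complex" assume \<omega>: "\<omega> \<in> weyl_states h"
  then interpret weyl_state h \<omega> by unfold_locales
  have "Re (\<omega> (weyl_mult h (weyl_star x) y)) \<le> weyl_norm h x * weyl_norm h y" for x y
    by (rule order_trans[OF complex_Re_le_cmod cmod_weyl_form_le[OF \<omega>]])
  from this[of a a] this[of a b] this[of b a] this[of b b]
  show "Re (\<omega> (weyl_mult h (weyl_star (a + b)) (a + b))) \<le> (weyl_norm h a + weyl_norm h b)\<^sup>2"
    by (simp add: weyl_star_add weyl_mult_add_left weyl_mult_add_right add power2_eq_square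
        algebra_simps)
qed simp

lemma weyl_norm_scale: "weyl_norm h (weyl_scale z a) \<le> cmod z * weyl_norm h a"
proof (rule weyl_norm_least)
  fix \<omega> :: "'a weyl \<Rightarrow> complex" assume \<omega>: "\<omega> \<in> weyl_states h"
  then interpret weyl_state h \<omega> by unfold_locales
  have "\<omega> (weyl_mult h (weyl_star (weyl_scale z a)) (weyl_scale z a))
      = of_real ((cmod z)\<^sup>2) * \<omega> (weyl_mult h (weyl_star a) a)"
    by (simp add: weyl_star_scale weyl_mult_scale_left weyl_mult_scale_right scale
        complex_norm_square mult_ac del: of_real_power)
  then show "Re (\<omega> (weyl_mult h (weyl_star (weyl_scale z a)) (weyl_scale z a))) \<le> (cmod z * weyl_norm h a)\<^sup>2"
    using weyl_norm_sq_upper[OF \<omega>, of a] by (simp add: power_mult_distrib mult_left_mono)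
qed simp

lemma weyl_norm_zero [simp]: "weyl_norm h 0 = 0"
  by (rule antisym) (use weyl_norm_scale[of h 0 0] in simp_all)

lemma weyl_scale_uminus: "weyl_scale (- 1) a = - a"
  by (metis weyl.scale_minus_left weyl.scale_one)

lemma weyl_norm_minus: "weyl_norm h (- a) = weyl_norm h a"
  using weyl_norm_scale[of h "- 1" a] weyl_norm_scale[of h "- 1" "- a"]
  by (simp add: weyl_scale_uminus)

lemma weyl_norm_minus_commute: "weyl_norm h (a - b) = weyl_norm h (b - a)"
  using weyl_norm_minus[of h "a - b"] by simp

lemma weyl_norm_diff_trans: "weyl_norm h (a - c) \<le> weyl_norm h (a - b) + weyl_norm h (b - c)"
  using weyl_norm_add[of h "a - b" "b - c"] by simp

lemma weyl_norm_reverse_triangle: "\<bar>weyl_norm h a - weyl_norm h b\<bar> \<le> weyl_norm h (a - b)"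
  using weyl_norm_add[of h "a - b" b] weyl_norm_add[of h "b - a" a]
  by (simp add: weyl_norm_minus_commute[of h b a])

text \<open>If \<open>\<omega> (b\<^sup>* b) > 0\<close>, then \<open>\<omega> (b\<^sup>* x b) / \<omega> (b\<^sup>* b)\<close> is again a state in \<open>x\<close>.\<close>

lemma cmod_weyl_conjugation_le:
  assumes r: "\<And>\<omega>. \<omega> \<in> weyl_states h \<Longrightarrow> cmod (\<omega> a) \<le> r" and \<omega>: "\<omega> \<in> weyl_states h"
  shows "cmod (\<omega> (weyl_mult h (weyl_star b) (weyl_mult h a b)))
         \<le> r * Re (\<omega> (weyl_mult h (weyl_star b) b))"
proof -
  interpret weyl_state h \<omega> by unfold_locales fact
  obtain p where p: "\<omega> (weyl_mult h (weyl_star b) b) = of_real p" "p \<ge> 0"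
    using nonneg[of b] by (auto elim!: nonneg_Reals_cases)
  show ?thesis
  proof (cases "p = 0")
    \<comment> \<open>No normalization is possible here, but Cauchy-Schwarz gives
      \<open>\<omega> (b\<^sup>* a b) = 0\<close>.\<close>
    case True
    then show ?thesis
      using cauchy_schwarz[of b "weyl_mult h a b"] p by simp
  next
    case False
    define \<rho> where "\<rho> = (\<lambda>x. of_real (1 / p) * \<omega> (weyl_mult h (weyl_star b) (weyl_mult h x b)))"
    have "Vector_Spaces.linear weyl_scale (*) \<rho>"
      by unfold_locales
         (simp_all add: \<rho>_def weyl_mult_add_left weyl_mult_add_right weyl_mult_scale_left
           weyl_mult_scale_right add scale algebra_simps del: of_real_divide)
    moreover have "\<rho> (weyl_mult h (weyl_star x) x) \<in> \<real>\<^sub>\<ge>\<^sub>0" for x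
    proof -
      have "weyl_mult h (weyl_star b) (weyl_mult h (weyl_mult h (weyl_star x) x) b)
          = weyl_mult h (weyl_star (weyl_mult h x b)) (weyl_mult h x b)"
        by (simp add: weyl_star_mult weyl_mult_assoc)
      then show ?thesis
        unfolding \<rho>_def using nonneg[of "weyl_mult h x b"] p by (intro nonneg_Reals_mult_I) auto
    qed
    moreover have "\<rho> weyl_one = 1"
      using p False by (simp add: \<rho>_def)
    ultimately have "\<rho> \<in> weyl_states h"
      by (simp add: weyl_states_def)
    from r[OF this] show ?thesis
      using p False by (simp add: \<rho>_def norm_mult norm_divide field_simps)
  qed
qed

text \<open>Since \<open>(a b)\<^sup>* (a b) = b\<^sup>* (a\<^sup>* a) b\<close>, the conjugation
  bound applies to \<open>a\<^sup>* a\<close>, on which states are at most the squared norm of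
  \<open>a\<close>.\<close>

lemma weyl_norm_mult: "weyl_norm h (weyl_mult h a b) \<le> weyl_norm h a * weyl_norm h b"
proof (rule weyl_norm_least)
  fix \<omega> :: "'a weyl \<Rightarrow> complex" assume \<omega>: "\<omega> \<in> weyl_states h"
  let ?B = "Re (\<omega> (weyl_mult h (weyl_star b) b))"
  have "Re (\<omega> (weyl_mult h (weyl_star (weyl_mult h a b)) (weyl_mult h a b)))
      \<le> cmod (\<omega> (weyl_mult h (weyl_star b) (weyl_mult h (weyl_mult h (weyl_star a) a) b)))"
    by (simp add: weyl_star_mult weyl_mult_assoc complex_Re_le_cmod)
  also have "\<dots> \<le> (weyl_norm h a)\<^sup>2 * ?B"
    by (rule cmod_weyl_conjugation_le[OF _ \<omega>]) (use cmod_weyl_form_le[of _ h a a] in \<open>simp add: power2_eq_square\<close>)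
  also have "\<dots> \<le> (weyl_norm h a)\<^sup>2 * (weyl_norm h b)\<^sup>2"
    by (intro mult_left_mono weyl_norm_sq_upper \<omega>) simp
  finally show "Re (\<omega> (weyl_mult h (weyl_star (weyl_mult h a b)) (weyl_mult h a b)))
      \<le> (weyl_norm h a * weyl_norm h b)\<^sup>2"
    by (simp add: power_mult_distrib)
qed simp

text \<open>The squared norm of \<open>b\<close> is at most the norm of \<open>b\<^sup>* b\<close>,
  hence at most the product of the norms of \<open>b\<^sup>*\<close> and \<open>b\<close>.
  Cancelling the norm of \<open>b\<close> gives one inequality, and replacing \<open>b\<close> by
  its adjoint the other.\<close>

lemma weyl_norm_star: "weyl_norm h (weyl_star a) = weyl_norm h a"
proof -
  have le: "weyl_norm h b \<le> weyl_norm h (weyl_star b)" for b :: "'a weyl"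
  proof -
    have "weyl_norm h b \<le> sqrt (weyl_norm h (weyl_star b) * weyl_norm h b)"
    proof (rule weyl_norm_least)
      fix \<omega> :: "'a weyl \<Rightarrow> complex" assume \<omega>: "\<omega> \<in> weyl_states h"
      have "Re (\<omega> (weyl_mult h (weyl_star b) b)) \<le> weyl_norm h (weyl_mult h (weyl_star b) b)"
        by (rule order_trans[OF complex_Re_le_cmod cmod_weyl_state_le[OF \<omega>]])
      also have "\<dots> \<le> weyl_norm h (weyl_star b) * weyl_norm h b"
        by (rule weyl_norm_mult)
      finally show "Re (\<omega> (weyl_mult h (weyl_star b) b))
          \<le> (sqrt (weyl_norm h (weyl_star b) * weyl_norm h b))\<^sup>2" by simp
    qed simp
    then have "(weyl_norm h b)\<^sup>2 \<le> weyl_norm h (weyl_star b) * weyl_norm h b"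
      by (metis abs_of_nonneg power2_abs real_sqrt_le_iff real_sqrt_abs weyl_norm_nonneg)
    then show ?thesis
      by (cases "weyl_norm h b = 0") (auto simp: power2_eq_square less_le)
  qed
  show ?thesis
    using le[of a] le[of "weyl_star a"] by (simp add: weyl_star_star)
qed

text \<open>
  Subtracting the bounds on \<open>\<omega> (b\<^sup>* a b)\<close> for \<open>b = a + s\<close> and \<open>b = a - s\<close>, where
  \<open>s\<^sup>2 = \<omega> (a\<^sup>2)\<close>, gives \<open>s \<le> r\<close>.
\<close>

lemma weyl_norm_self_adjoint_le:
  assumes a: "weyl_star a = a" and r: "\<And>\<omega>. \<omega> \<in> weyl_states h \<Longrightarrow> cmod (\<omega> a) \<le> r" and "0 \<le> r"
  shows "weyl_norm h a \<le> r"
proof (rule weyl_norm_least)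
  fix \<omega> :: "'a weyl \<Rightarrow> complex" assume \<omega>: "\<omega> \<in> weyl_states h"
  then interpret weyl_state h \<omega> by unfold_locales
  obtain p where p: "\<omega> (weyl_mult h a a) = of_real p" "p \<ge> 0"
    using nonneg[of a] a by (auto elim!: nonneg_Reals_cases)
  define s where "s = sqrt p"
  have s: "p = s\<^sup>2" "s \<ge> 0" using p by (simp_all add: s_def)
  let ?b = "\<lambda>t. a + weyl_scale (of_real t) weyl_one"
  have conj: "\<omega> (weyl_mult h (weyl_star (?b t)) (weyl_mult h a (?b t)))
      = \<omega> (weyl_mult h a (weyl_mult h a a)) + of_real (2 * t * p) + of_real (t\<^sup>2) * \<omega> a" for t
    by (simp only: weyl_star_add weyl_star_scale weyl_star_one a weyl_mult_add_left
        weyl_mult_add_right weyl_mult_scale_left weyl_mult_scale_right weyl_mult_one add scale p one)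
      (simp add: algebra_simps power2_eq_square)
  have sq: "Re (\<omega> (weyl_mult h (weyl_star (?b t)) (?b t))) = p + 2 * t * Re (\<omega> a) + t\<^sup>2" for t
    by (simp only: weyl_star_add weyl_star_scale weyl_star_one a weyl_mult_add_left
        weyl_mult_add_right weyl_mult_scale_left weyl_mult_scale_right weyl_mult_one add scale p one)
      (simp add: algebra_simps power2_eq_square)
  have "cmod (\<omega> (weyl_mult h (weyl_star (?b t)) (weyl_mult h a (?b t))))
      \<le> r * Re (\<omega> (weyl_mult h (weyl_star (?b t)) (?b t)))" for t
    by (rule cmod_weyl_conjugation_le) (fact r, fact \<omega>)
  then have le: "\<bar>Re (\<omega> (weyl_mult h a (weyl_mult h a a))) + 2 * t * p + t\<^sup>2 * Re (\<omega> a)\<bar>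
      \<le> r * (p + 2 * t * Re (\<omega> a) + t\<^sup>2)" for t
    using order_trans[OF abs_Re_le_cmod] unfolding conj sq by fastforce
  \<comment> \<open>The upper bound at \<open>s\<close> and the lower bound at \<open>- s\<close>
    are added: the terms with \<open>\<omega> a\<close> and with the cube of \<open>a\<close>
    cancel.\<close>
  from abs_le_D1[OF le[of s]] abs_le_D2[OF le[of "- s"]] have "4 * s * p \<le> 2 * r * (p + s\<^sup>2)"
    by (simp add: algebra_simps)
  then have "s * s\<^sup>2 \<le> r * s\<^sup>2" by (simp add: s)
  then have "s \<le> r"
    using s \<open>0 \<le> r\<close> by (cases "s = 0") auto
  then have "p \<le> r\<^sup>2"
    using s by (simp add: power_mono)
  then show "Re (\<omega> (weyl_mult h (weyl_star a) a)) \<le> r\<^sup>2"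
    by (simp add: a p)
qed fact

section \<open>Square roots\<close>

text \<open>
  For \<open>a \<le> 1\<close> the iterates converge to \<open>1 - sqrt (1 - a)\<close>. The scalar iterates at \<open>a = 1\<close>
  majorize the increments in norm, uniformly in \<open>a\<close> in the unit ball.
\<close>

primrec sqrt_iter :: "real \<Rightarrow> 'a::complex_hilbert_space weyl \<Rightarrow> nat \<Rightarrow> 'a weyl" where
  "sqrt_iter h a 0 = 0"
| "sqrt_iter h a (Suc k) =
     weyl_scale (1 / 2) (a + weyl_mult h (sqrt_iter h a k) (sqrt_iter h a k))"

primrec sqrt_iter_bound :: "nat \<Rightarrow> real" where
  "sqrt_iter_bound 0 = 0"
| "sqrt_iter_bound (Suc k) = (1 + (sqrt_iter_bound k)\<^sup>2) / 2"

section \<open>The scalar majorant and the estimates for the iterates\<close>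

lemma sqrt_iter_bound_range: "0 \<le> sqrt_iter_bound k" "sqrt_iter_bound k \<le> 1"
proof -
  have "0 \<le> sqrt_iter_bound k \<and> sqrt_iter_bound k \<le> 1"
    by (induction k) (auto simp: power_le_one)
  then show "0 \<le> sqrt_iter_bound k" "sqrt_iter_bound k \<le> 1" by simp_all
qed

text \<open>Each increment is half the square of \<open>sqrt_iter_bound k - 1\<close>.\<close>

lemma sqrt_iter_bound_incseq: "incseq sqrt_iter_bound"
proof (rule incseq_SucI)
  show "sqrt_iter_bound k \<le> sqrt_iter_bound (Suc k)" for k
    using zero_le_power2[of "sqrt_iter_bound k - 1"] by (simp add: power2_diff)
qed

lemma sqrt_iter_bound_convergent: "convergent sqrt_iter_bound"
  by (rule Bseq_mono_convergent)
     (use sqrt_iter_bound_range sqrt_iter_bound_incseq in \<open>auto intro!: BseqI'[of _ 1] simp: incseq_def\<close>)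

lemma weyl_star_sqrt_iter:
  "weyl_star a = a \<Longrightarrow> weyl_star (sqrt_iter h a k) = sqrt_iter h a k"
  by (induction k) (simp_all add: weyl_star_scale weyl_star_add weyl_star_mult)

text \<open>The difference splits as \<open>x (y - y') + (x - x') y'\<close>.\<close>

lemma weyl_norm_mult_diff:
  "weyl_norm h (weyl_mult h x y - weyl_mult h x' y')
    \<le> weyl_norm h x * weyl_norm h (y - y') + weyl_norm h (x - x') * weyl_norm h y'"
proof -
  have "weyl_mult h x (y - y') + weyl_mult h x y' = weyl_mult h x y"
    unfolding weyl_mult_add_right[symmetric] by simp
  moreover have "weyl_mult h (x - x') y' + weyl_mult h x' y' = weyl_mult h x y'"
    unfolding weyl_mult_add_left[symmetric] by simp
  ultimately have "weyl_mult h x y - weyl_mult h x' y' = weyl_mult h x (y - y') + weyl_mult h (x - x') y'"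
    by (metis add.assoc add_diff_cancel_right')
  then have "weyl_norm h (weyl_mult h x y - weyl_mult h x' y')
      \<le> weyl_norm h (weyl_mult h x (y - y')) + weyl_norm h (weyl_mult h (x - x') y')"
    by (simp add: weyl_norm_add)
  also have "\<dots> \<le> weyl_norm h x * weyl_norm h (y - y') + weyl_norm h (x - x') * weyl_norm h y'"
    by (intro add_mono weyl_norm_mult)
  finally show ?thesis .
qed

lemma weyl_norm_square_diff:
  "weyl_norm h (weyl_mult h x x - weyl_mult h y y) \<le> (weyl_norm h x + weyl_norm h y) * weyl_norm h (x - y)"
  using weyl_norm_mult_diff[of h x x y y] by (simp add: algebra_simps)

lemma weyl_norm_half_scale: "weyl_norm h (weyl_scale (1 / 2) a) \<le> weyl_norm h a / 2"
  using weyl_norm_scale[of h "1 / 2" a] by simp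

lemma weyl_norm_sqrt_iter_le:
  assumes "weyl_norm h a \<le> 1"
  shows "weyl_norm h (sqrt_iter h a k) \<le> sqrt_iter_bound k"
proof (induction k)
  case (Suc k)
  have "weyl_norm h (sqrt_iter h a (Suc k))
      \<le> weyl_norm h (a + weyl_mult h (sqrt_iter h a k) (sqrt_iter h a k)) / 2"
    by (simp only: sqrt_iter.simps weyl_norm_half_scale)
  also have "\<dots> \<le> (weyl_norm h a + weyl_norm h (sqrt_iter h a k) * weyl_norm h (sqrt_iter h a k)) / 2"
    by (intro divide_right_mono order_trans[OF weyl_norm_add add_left_mono[OF weyl_norm_mult]]) simp
  also have "\<dots> \<le> (1 + sqrt_iter_bound k * sqrt_iter_bound k) / 2"
    using assms Suc by (intro divide_right_mono add_mono mult_mono) (auto simp: sqrt_iter_bound_range)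
  finally show ?case by (simp add: power2_eq_square)
qed simp

text \<open>An increment of the iteration is half a difference of squares, bounded by half the sum
  of the norms times the previous increment. For the scalar majorant this bound is an equality, so
  the domination propagates.\<close>

lemma weyl_norm_sqrt_iter_Suc_diff:
  assumes "weyl_norm h a \<le> 1"
  shows "weyl_norm h (sqrt_iter h a (Suc k) - sqrt_iter h a k) \<le> sqrt_iter_bound (Suc k) - sqrt_iter_bound k"
proof (induction k)
  case 0
  show ?case using assms weyl_norm_half_scale[of h a] by simp
next
  case (Suc k)
  let ?x = "sqrt_iter h a (Suc k)" and ?y = "sqrt_iter h a k"
  have "sqrt_iter h a (Suc (Suc k)) - ?x = weyl_scale (1 / 2) (weyl_mult h ?x ?x - weyl_mult h ?y ?y)"
    by (simp add: weyl.scale_right_diff_distrib weyl.scale_right_distrib del: weyl.scale_scale)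
  then have "weyl_norm h (sqrt_iter h a (Suc (Suc k)) - ?x) \<le> weyl_norm h (weyl_mult h ?x ?x - weyl_mult h ?y ?y) / 2"
    using weyl_norm_half_scale by metis
  also have "\<dots> \<le> (weyl_norm h ?x + weyl_norm h ?y) * weyl_norm h (?x - ?y) / 2"
    by (intro divide_right_mono weyl_norm_square_diff) simp
  also have "\<dots> \<le> (sqrt_iter_bound (Suc k) + sqrt_iter_bound k) * (sqrt_iter_bound (Suc k) - sqrt_iter_bound k) / 2"
    using Suc by (intro divide_right_mono mult_mono add_mono weyl_norm_sqrt_iter_le assms add_nonneg_nonneg
        sqrt_iter_bound_range) auto
  also have "\<dots> = sqrt_iter_bound (Suc (Suc k)) - sqrt_iter_bound (Suc k)"
    unfolding sqrt_iter_bound.simps(2)[of "Suc k"] sqrt_iter_bound.simps(2)[of k]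
    by (simp add: power2_eq_square field_simps)
  finally show ?case .
qed

lemma weyl_norm_sqrt_iter_diff:
  assumes "weyl_norm h a \<le> 1" "k \<le> m"
  shows "weyl_norm h (sqrt_iter h a m - sqrt_iter h a k) \<le> sqrt_iter_bound m - sqrt_iter_bound k"
  using assms(2)
proof (induction m rule: dec_induct)
  case (step m)
  show ?case
    using weyl_norm_diff_trans[of h "sqrt_iter h a (Suc m)" "sqrt_iter h a k" "sqrt_iter h a m"]
      weyl_norm_sqrt_iter_Suc_diff[OF assms(1), of m] step.IH
    by linarith
qed simp

text \<open>In the unit ball one step adds half the distance of \<open>a\<close> and
  \<open>b\<close> and does not enlarge the earlier difference. The constant grows with
  \<open>k\<close>, so the estimate serves only at a fixed stage of the iteration.\<close>

lemma weyl_norm_sqrt_iter_lipschitz: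
  assumes "weyl_norm h a \<le> 1" "weyl_norm h b \<le> 1"
  shows "weyl_norm h (sqrt_iter h a k - sqrt_iter h b k) \<le> real k * weyl_norm h (a - b)"
proof (induction k)
  case (Suc k)
  let ?x = "sqrt_iter h a k" and ?y = "sqrt_iter h b k"
  have le1: "weyl_norm h ?x + weyl_norm h ?y \<le> 2"
    using weyl_norm_sqrt_iter_le[OF assms(1), of k] weyl_norm_sqrt_iter_le[OF assms(2), of k]
      sqrt_iter_bound_range(2)[of k] by simp
  have "sqrt_iter h a (Suc k) - sqrt_iter h b (Suc k)
      = weyl_scale (1 / 2) ((a - b) + (weyl_mult h ?x ?x - weyl_mult h ?y ?y))"
    by (simp add: weyl.scale_right_diff_distrib weyl.scale_right_distrib del: weyl.scale_scale)
  then have "weyl_norm h (sqrt_iter h a (Suc k) - sqrt_iter h b (Suc k))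
      \<le> weyl_norm h ((a - b) + (weyl_mult h ?x ?x - weyl_mult h ?y ?y)) / 2"
    using weyl_norm_half_scale by metis
  also have "\<dots> \<le> (weyl_norm h (a - b) + weyl_norm h (weyl_mult h ?x ?x - weyl_mult h ?y ?y)) / 2"
    by (intro divide_right_mono weyl_norm_add) simp
  also have "weyl_norm h (weyl_mult h ?x ?x - weyl_mult h ?y ?y) \<le> 2 * (real k * weyl_norm h (a - b))"
    using weyl_norm_square_diff mult_mono[OF le1 Suc] by (rule order_trans) auto
  finally have "weyl_norm h (sqrt_iter h a (Suc k) - sqrt_iter h b (Suc k))
      \<le> weyl_norm h (a - b) / 2 + real k * weyl_norm h (a - b)"
    by (simp add: field_simps)
  then show ?case
    using weyl_norm_nonneg[of h "a - b"] by (simp add: algebra_simps del: weyl_norm_nonneg sqrt_iter.simps)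
qed simp

section \<open>The completion\<close>

lemma weyl_cauchyI:
  assumes "\<And>e. e > 0 \<Longrightarrow> \<exists>M. \<forall>m\<ge>M. \<forall>n\<ge>M. weyl_norm h (x m - x n) < e"
  shows "x \<in> weyl_cauchy h"
  using assms by (simp add: weyl_cauchy_def)

lemma weyl_cauchyD:
  assumes "x \<in> weyl_cauchy h" "e > 0"
  obtains M where "\<And>m n. m \<ge> M \<Longrightarrow> n \<ge> M \<Longrightarrow> weyl_norm h (x m - x n) < e"
  using assms unfolding weyl_cauchy_def by blast

text \<open>Common source of the Cauchy property for all termwise operations. Separate parameters
  accommodate \<open>weyl_quant\<close>, which changes the algebra; unary operations take a constant
  sequence as second argument.\<close>

lemma weyl_cauchy_dominated:
  assumes "x \<in> weyl_cauchy h" "y \<in> weyl_cauchy k" "0 \<le> C"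
    and le: "\<And>m n. weyl_norm l (z m - z n) \<le> C * (weyl_norm h (x m - x n) + weyl_norm k (y m - y n))"
  shows "z \<in> weyl_cauchy l"
proof (rule weyl_cauchyI)
  fix e :: real assume "e > 0"
  \<comment> \<open>The summand \<open>1\<close> keeps the denominator positive when
    \<open>C = 0\<close> and makes the final estimate strict.\<close>
  define d where "d = e / (C + 1) / 2"
  have d: "d > 0" using \<open>e > 0\<close> \<open>0 \<le> C\<close> by (simp add: d_def)
  obtain M where M: "\<And>m n. m \<ge> M \<Longrightarrow> n \<ge> M \<Longrightarrow> weyl_norm h (x m - x n) < d"
    using weyl_cauchyD[OF assms(1) d] by blast
  obtain N where N: "\<And>m n. m \<ge> N \<Longrightarrow> n \<ge> N \<Longrightarrow> weyl_norm k (y m - y n) < d"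
    using weyl_cauchyD[OF assms(2) d] by blast
  have "weyl_norm l (z m - z n) < e" if "m \<ge> max M N" "n \<ge> max M N" for m n
  proof -
    have "weyl_norm l (z m - z n) \<le> C * (d + d)"
      using M[of m n] N[of m n] that \<open>0 \<le> C\<close> by (intro order_trans[OF le] mult_left_mono) auto
    also have "\<dots> < (C + 1) * (d + d)" using d by simp
    also have "d + d = e / (C + 1)" unfolding d_def by (rule field_sum_of_halves)
    also have "(C + 1) * (e / (C + 1)) = e" using \<open>0 \<le> C\<close> by simp
    finally show ?thesis .
  qed
  then show "\<exists>M. \<forall>m\<ge>M. \<forall>n\<ge>M. weyl_norm l (z m - z n) < e" by blast
qed

lemma weyl_null_dominated:
  assumes "(\<lambda>n. weyl_norm h (x n - x' n)) \<longlonglongrightarrow> 0" "(\<lambda>n. weyl_norm k (y n - y' n)) \<longlonglongrightarrow> 0"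
    and le: "\<And>n. weyl_norm l (z n) \<le> C * (weyl_norm h (x n - x' n) + weyl_norm k (y n - y' n))"
  shows "(\<lambda>n. weyl_norm l (z n)) \<longlonglongrightarrow> 0"
proof (rule tendsto_sandwich[of "\<lambda>_. 0"])
  show "(\<lambda>n. C * (weyl_norm h (x n - x' n) + weyl_norm k (y n - y' n))) \<longlonglongrightarrow> 0"
    using tendsto_mult_left[OF tendsto_add[OF assms(1,2)], of C] by simp
qed (use le in auto)

lemma weyl_cauchy_const: "(\<lambda>_. a) \<in> weyl_cauchy h"
  by (rule weyl_cauchyI) simp

lemma weyl_cauchy_norm_convergent:
  assumes "x \<in> weyl_cauchy h"
  shows "convergent (\<lambda>n. weyl_norm h (x n))"
  unfolding Cauchy_convergent_iff[symmetric]
proof (rule metric_CauchyI)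
  fix e :: real assume "e > 0"
  then obtain M where M: "\<And>m n. m \<ge> M \<Longrightarrow> n \<ge> M \<Longrightarrow> weyl_norm h (x m - x n) < e"
    using weyl_cauchyD[OF assms] by blast
  then show "\<exists>M. \<forall>m\<ge>M. \<forall>n\<ge>M. dist (weyl_norm h (x m)) (weyl_norm h (x n)) < e"
    unfolding dist_real_def using weyl_norm_reverse_triangle order_le_less_trans by blast
qed

lemma weyl_cauchy_bounded:
  assumes "x \<in> weyl_cauchy h"
  obtains B where "B > 0" "\<And>n. weyl_norm h (x n) \<le> B"
proof -
  have "Bseq (\<lambda>n. weyl_norm h (x n))"
    by (intro convergent_imp_Bseq weyl_cauchy_norm_convergent assms)
  then obtain B where "B > 0" "\<And>n. norm (weyl_norm h (x n)) \<le> B"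
    by (auto elim: BseqE)
  with that show ?thesis by simp
qed

text \<open>After scaling by a bound \<open>B\<close>, the element \<open>1 - x n / B\<close> is
  self-adjoint in the unit ball, and \<open>sqrt B * (1 - q)\<close> approximates the root of
  \<open>x n\<close>, with \<open>q\<close> an iterate. A diagonal choice ties the stage of the
  iteration to the index of the sequence.\<close>

lemma weyl_sqrt_exists:
  fixes x :: "nat \<Rightarrow> 'a::complex_hilbert_space weyl"
  assumes x: "x \<in> weyl_cauchy h" and star: "\<And>n. weyl_star (x n) = x n"
    and pos: "\<And>n \<omega>. \<omega> \<in> weyl_states h \<Longrightarrow> \<omega> (x n) \<in> \<real>\<^sub>\<ge>\<^sub>0"
  obtains z where "z \<in> weyl_cauchy h"
    and "(\<lambda>n. weyl_norm h (x n - weyl_mult h (weyl_star (z n)) (z n))) \<longlonglongrightarrow> 0"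
proof -
  obtain B where B: "B > 0" "\<And>n. weyl_norm h (x n) \<le> B"
    using weyl_cauchy_bounded[OF x] by blast
  define a where "a n = weyl_one - weyl_scale (of_real (1 / B)) (x n)" for n
  define q where "q n k = sqrt_iter h (a n) k" for n k
  define z where "z n = weyl_scale (of_real (sqrt B)) (weyl_one - q n n)" for n
  have a_star: "weyl_star (a n) = a n" for n
  proof -
    have "weyl_star (a n) + weyl_scale (of_real (1 / B)) (x n) = weyl_one"
      unfolding a_def using weyl_star_add[of "a n" "weyl_scale (of_real (1 / B)) (x n)"] star[of n]
      by (simp add: a_def weyl_star_scale)
    then show ?thesis by (simp add: a_def eq_diff_eq)
  qed
  \<comment> \<open>Every state maps \<open>a n\<close> into the interval from \<open>0\<close> to
    \<open>1\<close>, and for self-adjoint elements the states control the norm.\<close>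
  have a_norm: "weyl_norm h (a n) \<le> 1" for n
  proof (rule weyl_norm_self_adjoint_le[OF a_star])
    fix \<omega> :: "'a weyl \<Rightarrow> complex" assume \<omega>: "\<omega> \<in> weyl_states h"
    then interpret weyl_state h \<omega> by unfold_locales
    obtain p where p: "\<omega> (x n) = of_real p" "p \<ge> 0"
      using pos[OF \<omega>, of n] by (auto elim!: nonneg_Reals_cases)
    have "p \<le> B"
      using order_trans[OF cmod_weyl_state_le[OF \<omega>, of "x n"] B(2)] p by simp
    have "\<omega> (a n) = of_real (1 - p / B)"
      by (simp add: a_def diff scale p)
    then show "cmod (\<omega> (a n)) \<le> 1"
      using \<open>p \<le> B\<close> p B by (simp only: norm_of_real) (simp add: abs_le_iff field_simps)
  qed simp
  have a_diff: "weyl_norm h (a m - a n) \<le> weyl_norm h (x m - x n) / B" for m n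
  proof -
    have "a m - a n = weyl_scale (of_real (1 / B)) (x n - x m)"
      by (simp add: a_def weyl.scale_right_diff_distrib)
    then show ?thesis
      using weyl_norm_scale[of h "of_real (1 / B)" "x n - x m"] B
      by (simp add: weyl_norm_minus_commute[of h "x n"] norm_divide)
  qed
  \<comment> \<open>By the recursion, the defect of the approximate root is exactly a multiple of
    the next increment of the iteration.\<close>
  have sq: "weyl_mult h (weyl_star (z n)) (z n) - x n = weyl_scale (of_real (2 * B)) (q n (Suc n) - q n n)" for n
  proof -
    have zz: "weyl_mult h (z n) (z n) = weyl_scale (of_real B) (weyl_one - q n n - q n n + weyl_mult h (q n n) (q n n))"
    proof -
      have "weyl_mult h (weyl_one + weyl_scale (- 1) (q n n)) (weyl_one + weyl_scale (- 1) (q n n))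
          = weyl_one - q n n - q n n + weyl_mult h (q n n) (q n n)"
        unfolding weyl_mult_add_left weyl_mult_add_right weyl_mult_scale_left weyl_mult_scale_right
        by (simp add: weyl_scale_uminus)
      then show ?thesis
        using B by (simp add: z_def weyl_mult_scale_left weyl_mult_scale_right weyl_scale_uminus
            flip: of_real_mult)
    qed
    have zs: "weyl_star (z n) = z n"
    proof -
      have "weyl_star (weyl_one + weyl_scale (- 1) (q n n)) = weyl_one + weyl_scale (- 1) (q n n)"
        unfolding weyl_star_add weyl_star_scale q_def by (simp add: weyl_star_sqrt_iter a_star)
      then show ?thesis by (simp add: z_def weyl_star_scale weyl_scale_uminus)
    qed
    have qs: "q n (Suc n) = weyl_scale (1 / 2) (a n + weyl_mult h (q n n) (q n n))"
      by (simp add: q_def)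
    show ?thesis
      unfolding zs zz qs a_def
      by (intro poly_mapping_eqI, unfold lookup_weyl_scale lookup_add lookup_minus)
        (use B in \<open>simp add: field_simps\<close>)
  qed
  have cauchy: "Cauchy sqrt_iter_bound"
    using sqrt_iter_bound_convergent by (rule convergent_Cauchy)
  have "z \<in> weyl_cauchy h"
  proof (rule weyl_cauchyI)
    fix e :: real assume "e > 0"
    define d where "d = e / (4 * sqrt B)"
    have d: "d > 0" using \<open>e > 0\<close> B by (simp add: d_def)
    \<comment> \<open>\<open>K\<close> comes first: it makes the tails of the iteration small
      uniformly in \<open>n\<close>. Only then is \<open>M\<close> chosen, depending on the
      Lipschitz constant \<open>K\<close>.\<close>
    obtain K where K: "\<And>m n. m \<ge> K \<Longrightarrow> n \<ge> K \<Longrightarrow> dist (sqrt_iter_bound m) (sqrt_iter_bound n) < d"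
      using metric_CauchyD[OF cauchy d] by blast
    \<comment> \<open>Adding one to \<open>real K\<close> covers \<open>K = 0\<close>.\<close>
    have "d * B / (real K + 1) > 0" using d B by simp
    then obtain M where M: "\<And>m n. m \<ge> M \<Longrightarrow> n \<ge> M \<Longrightarrow> weyl_norm h (x m - x n) < d * B / (real K + 1)"
      using weyl_cauchyD[OF x] by blast
    have tail: "weyl_norm h (q n n - q n K) < d" if "n \<ge> K" for n
      using weyl_norm_sqrt_iter_diff[OF a_norm[of n] that] K[OF that order_refl]
      by (simp add: q_def dist_real_def)
    \<comment> \<open>The difference of \<open>q m m\<close> and \<open>q n n\<close> splits into
      two tails and a comparison at stage \<open>K\<close>, each below \<open>d\<close>; a fourth
      \<open>d\<close> is slack.\<close>
    have "weyl_norm h (z m - z n) < e" if mn: "m \<ge> max K M" "n \<ge> max K M" for m n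
    proof -
      have "weyl_norm h (q m K - q n K) \<le> real K * weyl_norm h (a m - a n)"
        unfolding q_def by (intro weyl_norm_sqrt_iter_lipschitz a_norm)
      also have "\<dots> \<le> (real K + 1) * (weyl_norm h (x m - x n) / B)"
        using a_diff by (intro mult_mono) auto
      also have "\<dots> < d"
        using M[of m n] mn B by (simp add: field_simps)
      finally have "weyl_norm h (q m K - q n K) < d" .
      moreover have "weyl_norm h (q m m - q m K) < d" "weyl_norm h (q n K - q n n) < d"
        using tail[of m] tail[of n] mn by (simp_all add: weyl_norm_minus_commute[of h "q n K"])
      ultimately have "weyl_norm h (q m m - q n n) < 3 * d"
        using weyl_norm_diff_trans[of h "q m m" "q n n" "q m K"]
          weyl_norm_diff_trans[of h "q m K" "q n n" "q n K"] by simp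
      moreover have "z m - z n = weyl_scale (of_real (sqrt B)) (q n n - q m m)"
        by (simp add: z_def weyl.scale_right_diff_distrib)
      then have "weyl_norm h (z m - z n) \<le> sqrt B * weyl_norm h (q m m - q n n)"
        using weyl_norm_scale[of h "of_real (sqrt B)" "q n n - q m m"] B
        by (simp add: weyl_norm_minus_commute[of h "q n n"])
      ultimately have "weyl_norm h (z m - z n) < sqrt B * (4 * d)"
        using B d by (smt (verit) mult_strict_left_mono real_sqrt_gt_zero)
      then show ?thesis using B by (simp add: d_def)
    qed
    then show "\<exists>M. \<forall>m\<ge>M. \<forall>n\<ge>M. weyl_norm h (z m - z n) < e" by blast
  qed
  moreover have "(\<lambda>n. weyl_norm h (x n - weyl_mult h (weyl_star (z n)) (z n))) \<longlonglongrightarrow> 0"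
  proof (rule tendsto_sandwich[of "\<lambda>_. 0"])
    \<comment> \<open>The increments of the convergent majorant tend to zero.\<close>
    obtain L where "sqrt_iter_bound \<longlonglongrightarrow> L"
      using sqrt_iter_bound_convergent by (auto simp: convergent_def)
    then have "(\<lambda>n. 2 * B * (sqrt_iter_bound (Suc n) - sqrt_iter_bound n)) \<longlonglongrightarrow> 2 * B * (L - L)"
      by (intro tendsto_intros LIMSEQ_Suc)
    then show "(\<lambda>n. 2 * B * (sqrt_iter_bound (Suc n) - sqrt_iter_bound n)) \<longlonglongrightarrow> 0" by simp
    have "weyl_norm h (x n - weyl_mult h (weyl_star (z n)) (z n))
        \<le> 2 * B * (sqrt_iter_bound (Suc n) - sqrt_iter_bound n)" for n
    proof -
      have "weyl_norm h (x n - weyl_mult h (weyl_star (z n)) (z n)) \<le> 2 * B * weyl_norm h (q n (Suc n) - q n n)"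
        using weyl_norm_scale[of h "of_real (2 * B)" "q n (Suc n) - q n n"] B
        unfolding weyl_norm_minus_commute[of h "x n"] sq norm_of_real by simp
      also have "\<dots> \<le> 2 * B * (sqrt_iter_bound (Suc n) - sqrt_iter_bound n)"
        unfolding q_def using B by (intro mult_left_mono weyl_norm_sqrt_iter_Suc_diff a_norm) simp
      finally show ?thesis .
    qed
    then show "\<forall>\<^sub>F n in sequentially. weyl_norm h (x n - weyl_mult h (weyl_star (z n)) (z n))
        \<le> 2 * B * (sqrt_iter_bound (Suc n) - sqrt_iter_bound n)" by simp
  qed auto
  ultimately show ?thesis by (rule that)
qed

section \<open>Classes modulo null sequences\<close>

lemma weyl_eqv_iff:
  "(x, y) \<in> weyl_eqv h \<longleftrightarrow> x \<in> weyl_cauchy h \<and> y \<in> weyl_cauchy h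
     \<and> (\<lambda>n. weyl_norm h (x n - y n)) \<longlonglongrightarrow> 0"
  by (simp add: weyl_eqv_def)

lemma weyl_eqv_trans:
  assumes "(x, y) \<in> weyl_eqv h" "(y, z) \<in> weyl_eqv h"
  shows "(x, z) \<in> weyl_eqv h"
proof -
  have "(\<lambda>n. weyl_norm h (x n - z n)) \<longlonglongrightarrow> 0"
    by (rule weyl_null_dominated[of h x y h y z _ _ 1])
       (use assms weyl_norm_diff_trans in \<open>auto simp: weyl_eqv_iff\<close>)
  then show ?thesis using assms by (simp add: weyl_eqv_iff)
qed

lemma equiv_weyl_eqv: "equiv (weyl_cauchy h) (weyl_eqv h)"
proof (rule equivI)
  show "weyl_eqv h \<subseteq> weyl_cauchy h \<times> weyl_cauchy h" by (auto simp: weyl_eqv_iff)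
  show "refl_on (weyl_cauchy h) (weyl_eqv h)" by (auto intro!: refl_onI simp: weyl_eqv_iff)
  show "sym (weyl_eqv h)" by (auto intro!: symI simp: weyl_eqv_iff weyl_norm_minus_commute)
  show "trans (weyl_eqv h)" by (blast intro: transI weyl_eqv_trans)
qed

abbreviation weyl_class :: "real \<Rightarrow> (nat \<Rightarrow> 'a::complex_hilbert_space weyl) \<Rightarrow> 'a weylC" where
  "weyl_class h x \<equiv> weyl_eqv h `` {x}"

lemma weylC_cases:
  assumes "X \<in> weylC h"
  obtains x where "x \<in> weyl_cauchy h" "X = weyl_class h x"
  using assms unfolding weylC_def by (auto elim: quotientE)

lemma weyl_class_in_weylC: "x \<in> weyl_cauchy h \<Longrightarrow> weyl_class h x \<in> weylC h"
  unfolding weylC_def by (rule quotientI)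

lemma weyl_class_eqI:
  assumes "x \<in> weyl_cauchy h" "y \<in> weyl_cauchy h" "(\<lambda>n. weyl_norm h (x n - y n)) \<longlonglongrightarrow> 0"
  shows "weyl_class h x = weyl_class h y"
  by (rule equiv_class_eq[OF equiv_weyl_eqv]) (use assms in \<open>simp add: weyl_eqv_iff\<close>)

text \<open>The operations of the completion are unions over representatives. Such a union collapses
  once \<open>G\<close> agrees on the whole class with its value at \<open>x\<close>.\<close>

lemma UN_weyl_class:
  assumes "x \<in> weyl_cauchy h"
    and "\<And>x'. (x, x') \<in> weyl_eqv h \<Longrightarrow> G x = G x'"
  shows "(\<Union>x'\<in>weyl_class h x. G x') = G x"
proof -
  have "(x, x) \<in> weyl_eqv h" using assms(1) by (simp add: weyl_eqv_iff)
  then show ?thesis using assms(2) by blast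
qed

lemma UN_weyl_class2:
  assumes "x \<in> weyl_cauchy h" "y \<in> weyl_cauchy h"
    and "\<And>x' y'. (x, x') \<in> weyl_eqv h \<Longrightarrow> (y, y') \<in> weyl_eqv h \<Longrightarrow> G x y = G x' y'"
  shows "(\<Union>x'\<in>weyl_class h x. \<Union>y'\<in>weyl_class h y. G x' y') = G x y"
proof -
  have "(x, x) \<in> weyl_eqv h" "(y, y) \<in> weyl_eqv h" using assms(1,2) by (simp_all add: weyl_eqv_iff)
  then show ?thesis using assms(3) by blast
qed

section \<open>The operations computed on representatives\<close>

lemma weyl_cauchy_add:
  assumes "x \<in> weyl_cauchy h" "y \<in> weyl_cauchy h"
  shows "(\<lambda>n. x n + y n) \<in> weyl_cauchy h"
  by (rule weyl_cauchy_dominated[OF assms, of 1])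
     (simp_all add: add_diff_add weyl_norm_add)

lemma weyl_cauchy_scale:
  assumes "x \<in> weyl_cauchy h"
  shows "(\<lambda>n. weyl_scale c (x n)) \<in> weyl_cauchy h"
proof (rule weyl_cauchy_dominated[OF assms weyl_cauchy_const[of 0 h], of "cmod c"])
  show "weyl_norm h (weyl_scale c (x m) - weyl_scale c (x n))
      \<le> cmod c * (weyl_norm h (x m - x n) + weyl_norm h (0 - 0))" for m n
    using weyl_norm_scale[of h c "x m - x n"] by (simp add: weyl.scale_right_diff_distrib)
qed simp

lemma weyl_star_diff: "weyl_star (a - b) = weyl_star a - weyl_star b"
  using weyl_star_add[of "a - b" b] by (simp add: eq_diff_eq)

lemma weyl_cauchy_star:
  assumes "x \<in> weyl_cauchy h"
  shows "(\<lambda>n. weyl_star (x n)) \<in> weyl_cauchy h"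
  by (rule weyl_cauchy_dominated[OF assms weyl_cauchy_const[of 0 h], of 1])
     (simp_all add: weyl_star_diff[symmetric] weyl_norm_star)

lemma weyl_cauchy_quant:
  assumes "x \<in> weyl_cauchy 0" "0 \<le> h"
  shows "(\<lambda>n. weyl_quant h (x n)) \<in> weyl_cauchy h"
  by (rule weyl_cauchy_dominated[OF assms(1) weyl_cauchy_const[of 0 h], of 1])
     (simp_all add: weyl_quant.diff[symmetric] weyl_norm_quant_le assms)

text \<open>Only \<open>x\<close> and \<open>y'\<close> need bounds, because the splitting of the
  difference multiplies by these two factors.\<close>

lemma weyl_norm_mult_diff_bounded:
  assumes "weyl_norm h x \<le> B" "weyl_norm h y' \<le> C"
  shows "weyl_norm h (weyl_mult h x y - weyl_mult h x' y')
    \<le> (B + C) * (weyl_norm h (x - x') + weyl_norm h (y - y'))"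
proof -
  have "0 \<le> B" "0 \<le> C"
    using assms weyl_norm_nonneg order_trans by blast+
  have "weyl_norm h (weyl_mult h x y - weyl_mult h x' y')
      \<le> weyl_norm h x * weyl_norm h (y - y') + weyl_norm h (x - x') * weyl_norm h y'"
    by (rule weyl_norm_mult_diff)
  also have "\<dots> \<le> B * (weyl_norm h (x - x') + weyl_norm h (y - y')) + (weyl_norm h (x - x') + weyl_norm h (y - y')) * C"
    using assms \<open>0 \<le> B\<close> \<open>0 \<le> C\<close> by (intro add_mono mult_mono) auto
  finally show ?thesis by (simp add: algebra_simps)
qed

lemma weyl_cauchy_mult:
  assumes "x \<in> weyl_cauchy h" "y \<in> weyl_cauchy h"
  shows "(\<lambda>n. weyl_mult h (x n) (y n)) \<in> weyl_cauchy h"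
proof -
  obtain B where "B > 0" "\<And>n. weyl_norm h (x n) \<le> B"
    using weyl_cauchy_bounded[OF assms(1)] by blast
  moreover obtain C where "C > 0" "\<And>n. weyl_norm h (y n) \<le> C"
    using weyl_cauchy_bounded[OF assms(2)] by blast
  ultimately show ?thesis
    by (intro weyl_cauchy_dominated[OF assms, of "B + C"] weyl_norm_mult_diff_bounded) auto
qed

lemma weylC_add_class:
  assumes "x \<in> weyl_cauchy h" "y \<in> weyl_cauchy h"
  shows "weylC_add h (weyl_class h x) (weyl_class h y) = weyl_class h (\<lambda>n. x n + y n)"
  unfolding weylC_add_def
proof (rule UN_weyl_class2[OF assms], rule weyl_class_eqI)
  fix x' y' assume xy: "(x, x') \<in> weyl_eqv h" "(y, y') \<in> weyl_eqv h"
  show "(\<lambda>n. weyl_norm h (x n + y n - (x' n + y' n))) \<longlonglongrightarrow> 0"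
    by (rule weyl_null_dominated[of h x x' h y y' _ _ 1])
       (use xy in \<open>simp_all add: weyl_eqv_iff add_diff_add weyl_norm_add\<close>)
qed (simp_all add: weyl_eqv_iff weyl_cauchy_add)

lemma weylC_scale_class:
  assumes "x \<in> weyl_cauchy h"
  shows "weylC_scale h c (weyl_class h x) = weyl_class h (\<lambda>n. weyl_scale c (x n))"
  unfolding weylC_scale_def
proof (rule UN_weyl_class[OF assms], rule weyl_class_eqI)
  fix x' assume x': "(x, x') \<in> weyl_eqv h"
  show "(\<lambda>n. weyl_norm h (weyl_scale c (x n) - weyl_scale c (x' n))) \<longlonglongrightarrow> 0"
  proof (rule weyl_null_dominated[of h x x' h x x' _ _ "cmod c"])
    show "weyl_norm h (weyl_scale c (x n) - weyl_scale c (x' n))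
        \<le> cmod c * (weyl_norm h (x n - x' n) + weyl_norm h (x n - x' n))" for n
      using order_trans[OF weyl_norm_scale[of h c "x n - x' n"] mult_left_mono]
      by (simp add: weyl.scale_right_diff_distrib)
  qed (use x' in \<open>simp_all add: weyl_eqv_iff\<close>)
qed (simp_all add: weyl_eqv_iff weyl_cauchy_scale)

lemma weylC_star_class:
  assumes "x \<in> weyl_cauchy h"
  shows "weylC_star h (weyl_class h x) = weyl_class h (\<lambda>n. weyl_star (x n))"
  unfolding weylC_star_def
  by (rule UN_weyl_class[OF assms], rule weyl_class_eqI)
     (simp_all add: weyl_eqv_iff weyl_cauchy_star weyl_star_diff[symmetric] weyl_norm_star)

lemma weylC_mult_class:
  assumes "x \<in> weyl_cauchy h" "y \<in> weyl_cauchy h"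
  shows "weylC_mult h (weyl_class h x) (weyl_class h y) = weyl_class h (\<lambda>n. weyl_mult h (x n) (y n))"
  unfolding weylC_mult_def
proof (rule UN_weyl_class2[OF assms], rule weyl_class_eqI)
  fix x' y' assume xy: "(x, x') \<in> weyl_eqv h" "(y, y') \<in> weyl_eqv h"
  obtain B where B: "B > 0" "\<And>n. weyl_norm h (x n) \<le> B"
    using weyl_cauchy_bounded[OF assms(1)] by blast
  obtain C where C: "C > 0" "\<And>n. weyl_norm h (y' n) \<le> C"
    using weyl_cauchy_bounded[of y' h] xy(2) unfolding weyl_eqv_iff by blast
  show "(\<lambda>n. weyl_norm h (weyl_mult h (x n) (y n) - weyl_mult h (x' n) (y' n))) \<longlonglongrightarrow> 0"
    by (rule weyl_null_dominated[of h x x' h y y' _ _ "B + C"])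
       (use xy in \<open>simp_all add: weyl_eqv_iff weyl_norm_mult_diff_bounded B C\<close>)
qed (simp_all add: weyl_eqv_iff weyl_cauchy_mult)

text \<open>By the reverse triangle inequality all representatives share one limit, so the definite
  description denotes it.\<close>

lemma weylC_norm_class:
  assumes x: "x \<in> weyl_cauchy h"
  shows "(\<lambda>n. weyl_norm h (x n)) \<longlonglongrightarrow> weylC_norm h (weyl_class h x)"
proof -
  obtain L where L: "(\<lambda>n. weyl_norm h (x n)) \<longlonglongrightarrow> L"
    using weyl_cauchy_norm_convergent[OF x] by (auto simp: convergent_def)
  have lim: "(\<lambda>n. weyl_norm h (y n)) \<longlonglongrightarrow> L" if "y \<in> weyl_class h x" for y
  proof (rule Lim_transform2[OF L])
    have "(\<lambda>n. weyl_norm h (x n - y n)) \<longlonglongrightarrow> 0"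
      using that by (simp add: weyl_eqv_iff)
    then show "(\<lambda>n. weyl_norm h (x n) - weyl_norm h (y n)) \<longlonglongrightarrow> 0"
      by (rule Lim_null_comparison[rotated]) (simp add: weyl_norm_reverse_triangle)
  qed
  have "x \<in> weyl_class h x" using x by (simp add: weyl_eqv_iff)
  then have "weylC_norm h (weyl_class h x) = L"
    unfolding weylC_norm_def using lim LIMSEQ_unique by (intro the_equality) blast+
  then show ?thesis using L by simp
qed

section \<open>Extension of the quantization map to the completion\<close>

definition weylC_quant :: "real \<Rightarrow> 'a::complex_hilbert_space weylC \<Rightarrow> 'a weylC" where
  "weylC_quant h X = (\<Union>x\<in>X. weyl_class h (\<lambda>n. weyl_quant h (x n)))"

lemma weylC_quant_class:
  assumes "x \<in> weyl_cauchy 0" "0 \<le> h"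
  shows "weylC_quant h (weyl_class 0 x) = weyl_class h (\<lambda>n. weyl_quant h (x n))"
  unfolding weylC_quant_def
proof (rule UN_weyl_class[OF assms(1)], rule weyl_class_eqI)
  fix x' assume x': "(x, x') \<in> weyl_eqv 0"
  show "(\<lambda>n. weyl_norm h (weyl_quant h (x n) - weyl_quant h (x' n))) \<longlonglongrightarrow> 0"
    by (rule weyl_null_dominated[of 0 x x' 0 "\<lambda>_. 0" "\<lambda>_. 0" _ _ 1])
       (use x' in \<open>simp_all add: weyl_eqv_iff weyl_quant.diff[symmetric] weyl_norm_quant_le assms\<close>)
qed (simp_all add: weyl_eqv_iff weyl_cauchy_quant assms)

lemma weylC_quant_emb:
  "0 \<le> h \<Longrightarrow> weylC_quant h (weylC_emb 0 c) = weylC_emb h (weyl_quant h c)"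
  unfolding weylC_emb_def by (rule weylC_quant_class) (simp_all add: weyl_cauchy_const)

lemma weylC_quant_linear:
  assumes "0 \<le> h"
  shows "weylC_linear 0 h (weylC_quant h)"
  unfolding weylC_linear_def
  by (auto elim!: weylC_cases simp: assms weylC_quant_class weylC_add_class weylC_scale_class
      weyl_cauchy_add weyl_cauchy_scale weyl_cauchy_quant weyl_class_in_weylC
      weyl_quant.add weyl_quant.scale)

text \<open>A positive class has a representative with terms \<open>y\<^sup>* y\<close>.
  Quantization is not multiplicative, so a root of the image must be built at \<open>h\<close>:
  states are nonnegative on the self-adjoint terms \<open>Q\<^sub>h(y\<^sup>* y)\<close>, and
  \<open>weyl_sqrt_exists\<close> applies.\<close>

lemma weylC_quant_positive:
  assumes "0 \<le> h" "weylC_positive 0 X"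
  shows "weylC_positive h (weylC_quant h X)"
proof -
  obtain y where y: "y \<in> weyl_cauchy 0"
    and X: "X = weyl_class 0 (\<lambda>n. weyl_mult 0 (weyl_star (y n)) (y n))"
    using assms(2) unfolding weylC_positive_def
    by (auto elim!: weylC_cases simp: weylC_star_class weylC_mult_class weyl_cauchy_star)
  define x where "x n = weyl_quant h (weyl_mult 0 (weyl_star (y n)) (y n))" for n
  have x: "x \<in> weyl_cauchy h"
    unfolding x_def by (intro weyl_cauchy_quant weyl_cauchy_mult weyl_cauchy_star y assms(1))
  have QX: "weylC_quant h X = weyl_class h x"
    unfolding X x_def by (intro weylC_quant_class weyl_cauchy_mult weyl_cauchy_star y assms(1))
  obtain z where z: "z \<in> weyl_cauchy h"
    and xz: "(\<lambda>n. weyl_norm h (x n - weyl_mult h (weyl_star (z n)) (z n))) \<longlonglongrightarrow> 0"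
  proof (rule weyl_sqrt_exists[OF x])
    show "weyl_star (x n) = x n" for n
      by (simp add: x_def weyl_star_quant weyl_star_mult weyl_star_star)
    show "\<omega> (x n) \<in> \<real>\<^sub>\<ge>\<^sub>0" if "\<omega> \<in> weyl_states h" for n \<omega>
      unfolding x_def using that assms(1) by (rule weyl_quant_nonneg)
  qed
  have "weyl_class h x = weyl_class h (\<lambda>n. weyl_mult h (weyl_star (z n)) (z n))"
    by (intro weyl_class_eqI x xz weyl_cauchy_mult weyl_cauchy_star z)
  also have "\<dots> = weylC_mult h (weylC_star h (weyl_class h z)) (weyl_class h z)"
    by (simp add: weylC_star_class weylC_mult_class weyl_cauchy_star z)
  finally show ?thesis
    unfolding weylC_positive_def QX using weyl_class_in_weylC[OF z] by blast
qed

lemma weylC_norm_quant_le: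
  assumes "0 \<le> h" "X \<in> weylC 0"
  shows "weylC_norm h (weylC_quant h X) \<le> weylC_norm 0 X"
proof -
  obtain x where x: "x \<in> weyl_cauchy 0" "X = weyl_class 0 x"
    using assms(2) by (rule weylC_cases)
  then show ?thesis
    using LIMSEQ_le[OF weylC_norm_class[OF weyl_cauchy_quant[OF x(1) assms(1)]] weylC_norm_class[OF x(1)]]
      weyl_norm_quant_le[OF assms(1)] assms(1)
    by (auto simp: weylC_quant_class)
qed

theorem proposition3p4:
  fixes h :: real
  assumes separable: "separable_space (euclidean :: 'a::complex_hilbert_space topology)"
    and h: "0 \<le> h"
  shows "(\<forall>c :: 'a weyl. weyl_norm h (weyl_quant h c) \<le> weyl_norm 0 c)
       \<and> (\<forall>c :: 'a weyl. weylC_positive 0 (weylC_emb 0 c)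
              \<longrightarrow> weylC_positive h (weylC_emb h (weyl_quant h c)))
       \<and> (\<exists>Q :: 'a weylC \<Rightarrow> 'a weylC.
              weylC_positive_map 0 h Q
            \<and> (\<forall>X\<in>weylC 0. weylC_norm h (Q X) \<le> weylC_norm 0 X)
            \<and> (\<forall>c. Q (weylC_emb 0 c) = weylC_emb h (weyl_quant h c)))"
proof (intro conjI allI impI exI[of _ "weylC_quant h"] ballI)
  fix c :: "'a weyl"
  show "weyl_norm h (weyl_quant h c) \<le> weyl_norm 0 c"
    using h by (rule weyl_norm_quant_le)
  show emb: "weylC_quant h (weylC_emb 0 c) = weylC_emb h (weyl_quant h c)"
    using h by (rule weylC_quant_emb)
  \<comment> \<open>Part (ii) is positivity of the extension at an embedded element.\<close>
  show "weylC_positive h (weylC_emb h (weyl_quant h c))" if "weylC_positive 0 (weylC_emb 0 c)"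
    using weylC_quant_positive[OF h that] unfolding emb .
next
  show "weylC_positive_map 0 h (weylC_quant h :: 'a weylC \<Rightarrow> 'a weylC)"
    unfolding weylC_positive_map_def using h by (simp add: weylC_quant_linear weylC_quant_positive)
  show "weylC_norm h (weylC_quant h X) \<le> weylC_norm 0 X" if "X \<in> weylC 0" for X :: "'a weylC"
    using h that by (rule weylC_norm_quant_le)
qed

end
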